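(* Let $\alpha\in(\tfrac12,1)$ and let $v_N(\alpha)$ be the asymptotic speed of the $N$-particle Bernoulli branching-selection process with parameter $\alpha$. Then $$\lim_{N\to\infty}\frac{1-v_N(\alpha)}{(q_\alpha)^N}=1,\qquad\text{where}\qquad q_\alpha=\frac{1-2\alpha(1-\alpha)-\sqrt{1-4\alpha(1-\alpha)}}{2\alpha^2}$$ is the extinction probability of the Galton-Watson process, started from one individual, whose offspring distribution is the Binomial distribution with parameters $(2,\alpha)$.
   Context: The Bernoulli branching-selection process with parameter $\alpha$ is the discrete-time system of $N$ particles on $\mathbb{Z}$, all starting at the origin, such that at each time unit: (1) each of the $N$ particles is replaced by two particles, each of which, independently of everything else, moves one step to the right with probability $\alpha$ and stays put with probability $1-\alpha$ (i.e. a particle at $\ell$ is replaced by $\mathcal{X}$ particles at $\ell+1$ and $2-\mathcal{X}$ particles at $\ell$, with $\mathcal{X}$ Binomial$(2,\alpha)$, independently for different particles and times); (2) among the $2N$ new particles only the $N$ rightmost are kept. Let $\max Y^N_k$ be the position of the rightmost particle at time $k$. The speed $v_N(\alpha)$ is the deterministic constant $v_N(\alpha)=\lim_{k\to\infty}(\max Y^N_k)/k$ (almost sure limit, which exists). *)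

theory Defs
  imports "HOL-Probability.Probability"
begin

definition offspring_space :: "nat pmf \<Rightarrow> (nat \<times> nat \<Rightarrow> nat) measure" where
  "offspring_space p = PiM UNIV (\<lambda>_. measure_pmf p)"

text \<open>
  The coordinates \<^term>\<open>\<xi> (k, i)\<close> of \<^term>\<open>offspring_space p\<close> are i.i.d. with law
  \<^term>\<open>p\<close>; \<^term>\<open>\<xi> (k, i)\<close> is attached to the \<^term>\<open>i\<close>-th individual alive at time
  \<^term>\<open>k\<close>. In a Galton-Watson process it is the number of children of that individual; in the
  Bernoulli branching-selection process (\<^term>\<open>p = binomial_pmf 2 \<alpha>\<close>) it is the number of
  children, out of two, that move one step to the right.
\<close>

primrec gw :: "nat \<Rightarrow> (nat \<times> nat \<Rightarrow> nat) \<Rightarrow> nat" where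
  "gw 0 \<xi> = 1"
| "gw (Suc n) \<xi> = (\<Sum>i<gw n \<xi>. \<xi> (n, i))"

definition gw_extinction_prob :: "nat pmf \<Rightarrow> real" where
  "gw_extinction_prob p = measure (offspring_space p) {\<xi>. \<exists>n. gw n \<xi> = 0}"

text \<open>
  A configuration is a list of particle positions. Almost surely \<^prop>\<open>x i \<le> 2\<close>, so that the
  truncated subtraction below is harmless.
\<close>

definition branch :: "(nat \<Rightarrow> nat) \<Rightarrow> int list \<Rightarrow> int list" where
  "branch x ys =
     concat (map (\<lambda>i. replicate (x i) (ys ! i + 1) @ replicate (2 - x i) (ys ! i)) [0..<length ys])"

definition keep_rightmost :: "nat \<Rightarrow> int list \<Rightarrow> int list" where
  "keep_rightmost N ys = take N (rev (sort ys))"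

primrec bbs :: "nat \<Rightarrow> nat \<Rightarrow> (nat \<times> nat \<Rightarrow> nat) \<Rightarrow> int list" where
  "bbs N 0 \<xi> = replicate N 0"
| "bbs N (Suc k) \<xi> = keep_rightmost N (branch (\<lambda>i. \<xi> (k, i)) (bbs N k \<xi>))"

definition speed :: "real \<Rightarrow> nat \<Rightarrow> real" where
  "speed \<alpha> N =
     (THE v. AE \<xi> in offspring_space (binomial_pmf 2 \<alpha>).
        (\<lambda>k. real_of_int (Max (set (bbs N k \<xi>))) / real k) \<longlonglongrightarrow> v)"

definition q :: "real \<Rightarrow> real" where
  "q \<alpha> = (1 - 2 * \<alpha> * (1 - \<alpha>) - sqrt (1 - 4 * \<alpha> * (1 - \<alpha>))) / (2 * \<alpha>\<^sup>2)"

end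

(* Idea.  Let R be the number of particles at the rightmost site, S the number of particles on the
   two rightmost sites, and f(s) = (1 - alpha + alpha s)^2, so that f(q) = q.  The front fails to move
   exactly if B = 0, where B ~ Bin(2R, alpha) counts the leaders' children that jump; otherwise the
   new number of leaders is min N B.  Since q^B has mean q^R, comparing q^R before and after a step
   gives
     P(B = 0) = E q^R - E q^R' + E (q^N - q^B)^+ + E [q^R'; B = 0].
   Averaged over time the first difference telescopes away, so 1 - v_N is governed by the last two
   terms.  The drift E s^R' <= f(s)^R + s^N for q < s < 1 yields E s^R <= K s^N at all times: the
   number of leaders stays within O(1) of N, hence the third term is q^N (1 + o(1)).  After a failure
   R' >= min N (2R + C), where C is the number of particles that join from the second site; the
   potential q^R b^S with q < b < 1 is again contracted, and shows that the last term is o(q^N).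
   The almost sure speed exists because all particles coalesce at one site with positive probability
   in N steps (Doeblin), which makes the mean heights almost additive and the centred height a
   martingale with bounded increments up to a bounded error; fourth moments then suffice. *)
theory Submission
  imports Defs
begin

section \<open>Processes driven by the rows of the offspring space\<close>

text \<open>With all \<open>N\<close> particles at one site, the next step fails with probability
  only \<open>(1 - \<alpha>) ^ (2 * N)\<close>, exponentially smaller than
  \<open>q \<alpha> ^ N\<close>. Failures of order \<open>q \<alpha> ^ N\<close> therefore end
  longer excursions, in which the line of leaders dies out like a Galton-Watson process, and no
  one-step estimate from a full site can see them. The power of \<open>q \<alpha>\<close> is
  harmonic for the leaders, up to the cutoff at \<open>N\<close> and the restart after a failure, so
  it accounts for a whole excursion through a one-step comparison. The price is that this function
  is neutral: it has no drift that would control its own mean. A base \<open>s\<close> above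
  \<open>q \<alpha>\<close> does contract, but gives only \<open>s ^ N\<close>, too large by
  \<open>(s / q \<alpha>) ^ N\<close>. The error after a failure must nevertheless be smaller than
  \<open>q \<alpha> ^ N\<close>; the factor in \<open>b\<close> exists to regain this loss, and at
  the end the two bases are chosen with \<open>b * s < q \<alpha>\<close>.\<close>

lemma expectation_pair_pmf_finite:
  fixes f :: "'a \<times> 'b \<Rightarrow> real"
  assumes "finite (set_pmf p)" "finite (set_pmf r)"
  shows "measure_pmf.expectation (pair_pmf p r) f =
         measure_pmf.expectation p (\<lambda>a. measure_pmf.expectation r (\<lambda>b. f (a, b)))"
proof -
  have *: "pair_pmf p r = bind_pmf p (\<lambda>a. map_pmf (Pair a) r)"
    by (simp add: pair_pmf_def map_pmf_def)
  have "measure_pmf.expectation (pair_pmf p r) f =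
     (\<Sum>a\<in>set_pmf p. pmf p a *\<^sub>R measure_pmf.expectation (map_pmf (Pair a) r) f)"
    unfolding * by (rule pmf_expectation_bind) (use assms in auto)
  also have "\<dots> = measure_pmf.expectation p (\<lambda>a. measure_pmf.expectation r (\<lambda>b. f (a, b)))"
    using assms by (simp add: integral_measure_pmf[of "set_pmf p"])
  finally show ?thesis .
qed

text \<open>Zero is the default value of \<open>Pi_pmf\<close>, so the restriction is again a total
  function and the law of finitely many coordinates can be compared directly with a pmf.\<close>

definition restrict0 :: "'i set \<Rightarrow> ('i \<Rightarrow> nat) \<Rightarrow> 'i \<Rightarrow> nat" where
  "restrict0 J \<xi> = (\<lambda>i. if i \<in> J then \<xi> i else 0)"

text \<open>For finite \<open>J\<close> both laws live on the countable set of functions that vanish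
  outside \<open>J\<close>, so it is enough to compare them on singletons, whose preimages are
  cylinder sets.\<close>

lemma
  assumes J: "finite J"
  shows measurable_restrict0:
      "restrict0 J \<in> measurable (offspring_space p) (count_space UNIV)"
    and distr_offspring_space_restrict0:
      "distr (offspring_space p) (count_space UNIV) (restrict0 J) = measure_pmf (Pi_pmf J 0 (\<lambda>_. p))"
proof -
  interpret product_prob_space "\<lambda>_. measure_pmf p" "UNIV :: (nat \<times> nat) set"
    by unfold_locales
  let ?D = "PiE_dflt J 0 (\<lambda>_. UNIV :: nat set)"
  have cD: "countable ?D"
    unfolding dflt_image_PiE[symmetric] by (intro countable_image countable_PiE J) auto
  have sp: "space (offspring_space p) = UNIV"
    by (auto simp: offspring_space_def space_PiM)
  have vim: "restrict0 J -` {f} = {\<xi>. \<forall>i\<in>J. \<xi> i \<in> {f i}}" if "f \<in> ?D" for f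
    using that by (auto simp: restrict0_def PiE_dflt_def fun_eq_iff)
  have sets: "{\<xi>. \<forall>i\<in>J. \<xi> i \<in> {f i}} \<in> sets (offspring_space p)" for f :: "nat \<times> nat \<Rightarrow> nat"
  proof -
    have "{\<xi> \<in> space (offspring_space p). \<forall>i\<in>J. \<xi> i \<in> {f i}} \<in> sets (offspring_space p)"
    proof (rule sets.sets_Collect_finite_All[OF _ J])
      fix i assume "i \<in> J"
      have "(\<lambda>\<xi>. \<xi> i) -` {f i} \<inter> space (offspring_space p) \<in> sets (offspring_space p)"
        unfolding offspring_space_def by (rule measurable_sets[OF measurable_component_singleton]) auto
      then show "{\<xi> \<in> space (offspring_space p). \<xi> i \<in> {f i}} \<in> sets (offspring_space p)"
        by (simp add: sp vimage_def)
    qed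
    then show ?thesis by (simp add: sp)
  qed
  have "restrict0 J \<in> measurable (offspring_space p) (count_space ?D)"
    unfolding measurable_count_space_eq_countable[OF cD] using sets vim
    by (auto simp: sp restrict0_def PiE_dflt_def)
  then show m: "restrict0 J \<in> measurable (offspring_space p) (count_space UNIV)"
    by (rule measurable_compose) auto
  show "distr (offspring_space p) (count_space UNIV) (restrict0 J) = measure_pmf (Pi_pmf J 0 (\<lambda>_. p))"
  proof (rule measure_eqI_countable_AE[of _ _ ?D])
    show "AE x in distr (offspring_space p) (count_space UNIV) (restrict0 J). x \<in> ?D"
      by (subst AE_distr_iff[OF m]) (auto simp: restrict0_def PiE_dflt_def)
    show "AE x in measure_pmf (Pi_pmf J 0 (\<lambda>_. p)). x \<in> ?D"
      using set_Pi_pmf_subset'[OF J, of 0 "\<lambda>_. p"] by (auto simp: AE_measure_pmf_iff PiE_dflt_def)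
    fix f assume f: "f \<in> ?D"
    have "emeasure (distr (offspring_space p) (count_space UNIV) (restrict0 J)) {f}
        = emeasure (offspring_space p) {\<xi>. \<forall>i\<in>J. \<xi> i \<in> {f i}}"
      by (subst emeasure_distr[OF m]) (auto simp: sp vim[OF f])
    also have "\<dots> = (\<Prod>i\<in>J. emeasure (measure_pmf p) {f i})"
      using emeasure_PiM_Collect[of J "\<lambda>i. {f i}"] J by (simp add: offspring_space_def space_PiM)
    also have "\<dots> = ennreal (pmf (Pi_pmf J 0 (\<lambda>_. p)) f)"
      using f J by (subst pmf_Pi') (auto simp: PiE_dflt_def emeasure_pmf_single prod_ennreal)
    finally show "emeasure (distr (offspring_space p) (count_space UNIV) (restrict0 J)) {f} =
      emeasure (measure_pmf (Pi_pmf J 0 (\<lambda>_. p))) {f}"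
      by (simp add: emeasure_pmf_single)
  qed (use cD in auto)
qed

section \<open>Markov operators of processes driven by independent rows\<close>

definition draws :: "nat pmf \<Rightarrow> nat \<Rightarrow> (nat \<Rightarrow> nat) pmf" where
  "draws p m = Pi_pmf {..<m} 0 (\<lambda>_. p)"

text \<open>This is the Markov operator of the chain with random update \<open>F x\<close>. Means at
  time \<open>k\<close> become values of its \<open>k\<close>-th iterate, so the drift estimates can
  be made without the infinite product space.\<close>

definition transition ::
    "nat pmf \<Rightarrow> nat \<Rightarrow> ((nat \<Rightarrow> nat) \<Rightarrow> 'a \<Rightarrow> 'a) \<Rightarrow> ('a \<Rightarrow> real) \<Rightarrow> 'a \<Rightarrow> real" where
  "transition p m F f z = measure_pmf.expectation (draws p m) (\<lambda>x. f (F x z))"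

definition env_row :: "nat \<Rightarrow> nat \<Rightarrow> (nat \<times> nat \<Rightarrow> nat) \<Rightarrow> nat \<Rightarrow> nat" where
  "env_row m k \<xi> = (\<lambda>i. if i < m then \<xi> (k, i) else 0)"

lemma finite_set_Pi_pmf:
  assumes "finite J" "\<And>i. i \<in> J \<Longrightarrow> finite (set_pmf (p i))"
  shows "finite (set_pmf (Pi_pmf J d p))"
  using assms by (simp add: set_Pi_pmf finite_PiE_dflt)

lemma finite_set_draws: "finite (set_pmf p) \<Longrightarrow> finite (set_pmf (draws p m))"
  by (simp add: draws_def finite_set_Pi_pmf)

lemma map_env_row_Pi_pmf: "map_pmf (env_row m k) (Pi_pmf ({k} \<times> {..<m}) 0 (\<lambda>_. p)) = draws p m"
proof -
  have bij: "bij_betw (Pair k) {..<m} ({k} \<times> {..<m})"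
    by (auto simp: bij_betw_def inj_on_def)
  have "draws p m = map_pmf (\<lambda>g. g \<circ> Pair k) (Pi_pmf ({k} \<times> {..<m}) 0 (\<lambda>_. p))"
    unfolding draws_def by (rule Pi_pmf_bij_betw) (use bij in auto)
  also have "\<dots> = map_pmf (env_row m k) (Pi_pmf ({k} \<times> {..<m}) 0 (\<lambda>_. p))"
  proof (rule map_pmf_cong[OF refl])
    fix g assume "g \<in> set_pmf (Pi_pmf ({k} \<times> {..<m}) 0 (\<lambda>_. p))"
    then have "\<forall>x. x \<notin> {k} \<times> {..<m} \<longrightarrow> g x = 0"
      using set_Pi_pmf_subset[of "{k} \<times> {..<m}" 0 "\<lambda>_. p"] by blast
    then show "g \<circ> Pair k = env_row m k g" by (auto simp: env_row_def fun_eq_iff)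
  qed
  finally show ?thesis by simp
qed

text \<open>Row \<open>k\<close> drives the step from time \<open>k\<close> to \<open>k + 1\<close>,
  so the state at time \<open>k\<close> is a function of the earlier rows only. Both the particle
  system and the truncated Galton-Watson process fit this form.\<close>

locale row_process =
  fixes p :: "nat pmf" and m :: nat and F :: "(nat \<Rightarrow> nat) \<Rightarrow> 'a \<Rightarrow> 'a"
    and Z :: "nat \<Rightarrow> (nat \<times> nat \<Rightarrow> nat) \<Rightarrow> 'a" and z0 :: 'a
  assumes finite_support: "finite (set_pmf p)"
    and Z_0: "Z 0 \<xi> = z0"
    and Z_Suc: "Z (Suc k) \<xi> = F (env_row m k \<xi>) (Z k \<xi>)"
begin

lemma Z_cong: "(\<And>j i. j < k \<Longrightarrow> i < m \<Longrightarrow> \<xi> (j, i) = \<xi>' (j, i)) \<Longrightarrow> Z k \<xi> = Z k \<xi>'"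
proof (induction k)
  case (Suc k)
  have "env_row m k \<xi> = env_row m k \<xi>'" using Suc.prems by (auto simp: env_row_def)
  moreover have "Z k \<xi> = Z k \<xi>'" by (rule Suc.IH) (use Suc.prems in auto)
  ultimately show ?case by (simp add: Z_Suc)
qed (simp add: Z_0)

text \<open>The last row is independent of the preceding ones; integrating it out replaces
  \<open>f\<close> by its image under the operator, which is why the induction is over all
  \<open>f\<close>.\<close>

lemma expectation_Pi_pmf_Z:
  "measure_pmf.expectation (Pi_pmf ({..<k} \<times> {..<m}) 0 (\<lambda>_. p)) (\<lambda>\<xi>. f (Z k \<xi>)) =
   (transition p m F ^^ k) f z0"
proof (induction k arbitrary: f)
  case 0
  then show ?case by (simp add: Z_0)
next
  case (Suc k)
  let ?A = "{..<k} \<times> {..<m}" and ?B = "{k} \<times> {..<m}"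
  let ?PA = "Pi_pmf ?A 0 (\<lambda>_. p)" and ?PB = "Pi_pmf ?B 0 (\<lambda>_. p)"
  let ?h = "\<lambda>(f,g) x. if x \<in> ?A then f x else g x :: nat"
  have fin: "finite (set_pmf ?PA)" "finite (set_pmf ?PB)"
    by (auto intro!: finite_set_Pi_pmf finite_support)
  have un: "{..<Suc k} \<times> {..<m} = ?A \<union> ?B" by (auto simp: less_Suc_eq)
  have "Pi_pmf ({..<Suc k} \<times> {..<m}) 0 (\<lambda>_. p) = map_pmf ?h (pair_pmf ?PA ?PB)"
    unfolding un by (rule Pi_pmf_union) auto
  then have "measure_pmf.expectation (Pi_pmf ({..<Suc k} \<times> {..<m}) 0 (\<lambda>_. p)) (\<lambda>\<xi>. f (Z (Suc k) \<xi>))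
     = measure_pmf.expectation ?PA (\<lambda>a. measure_pmf.expectation ?PB (\<lambda>b. f (Z (Suc k) (?h (a, b)))))"
    by (simp add: expectation_pair_pmf_finite[OF fin])
  also have "(\<lambda>a b. f (Z (Suc k) (?h (a, b)))) = (\<lambda>a b. f (F (env_row m k b) (Z k a)))"
  proof (intro ext)
    fix a b
    have "Z k (?h (a, b)) = Z k a" by (rule Z_cong) auto
    moreover have "env_row m k (?h (a, b)) = env_row m k b" by (auto simp: env_row_def)
    ultimately show "f (Z (Suc k) (?h (a, b))) = f (F (env_row m k b) (Z k a))" by (simp only: Z_Suc)
  qed
  also have "(\<lambda>a. measure_pmf.expectation ?PB (\<lambda>b. f (F (env_row m k b) (Z k a)))) =
      (\<lambda>a. transition p m F f (Z k a))"
    unfolding transition_def by (subst map_env_row_Pi_pmf[symmetric, of _ _ k]) simp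
  also have "measure_pmf.expectation ?PA (\<lambda>a. transition p m F f (Z k a)) =
      (transition p m F ^^ k) (transition p m F f) z0"
    by (rule Suc.IH)
  finally show ?case by (simp add: funpow_swap1)
qed

text \<open>\<open>Z k\<close> factors through the finite block of entries in the first
  \<open>k\<close> rows, whose law has finite support; this makes every real function of the state
  integrable.\<close>

lemma
  shows expectation_Z: "(\<integral>\<xi>. f (Z k \<xi>) \<partial>offspring_space p) = (transition p m F ^^ k) f z0"
    and integrable_Z: "integrable (offspring_space p) (\<lambda>\<xi>. f (Z k \<xi>) :: real)"
proof -
  let ?J = "{..<k} \<times> {..<m}"
  have eq: "Z k \<xi> = Z k (restrict0 ?J \<xi>)" for \<xi> by (rule Z_cong) (auto simp: restrict0_def)
  note M = measurable_restrict0[of ?J p]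
  have D: "distr (offspring_space p) (count_space UNIV) (restrict0 ?J) = measure_pmf (Pi_pmf ?J 0 (\<lambda>_. p))"
    by (rule distr_offspring_space_restrict0) auto
  have "(\<integral>\<xi>. f (Z k \<xi>) \<partial>offspring_space p) = (\<integral>\<xi>. f (Z k \<xi>) \<partial>Pi_pmf ?J 0 (\<lambda>_. p))"
    unfolding D[symmetric] by (subst integral_distr[OF M]) (auto simp: eq[symmetric])
  then show "(\<integral>\<xi>. f (Z k \<xi>) \<partial>offspring_space p) = (transition p m F ^^ k) f z0"
    by (simp add: expectation_Pi_pmf_Z)
  have "integrable (measure_pmf (Pi_pmf ?J 0 (\<lambda>_. p))) (\<lambda>\<xi>. f (Z k \<xi>))"
    by (intro integrable_measure_pmf_finite finite_set_Pi_pmf finite_support) auto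
  then show "integrable (offspring_space p) (\<lambda>\<xi>. f (Z k \<xi>))"
    unfolding D[symmetric] by (subst (asm) integrable_distr_eq[OF M]) (auto simp: eq[symmetric])
qed

end

lemma prob_space_offspring_space: "prob_space (offspring_space p)"
  unfolding offspring_space_def by (intro prob_space_PiM measure_pmf.prob_space_axioms)

lemma AE_offspring_space:
  assumes "\<And>n. n \<in> set_pmf p \<Longrightarrow> P n"
  shows "AE \<xi> in offspring_space p. \<forall>i. P (\<xi> i)"
proof -
  interpret product_prob_space "\<lambda>_. measure_pmf p" "UNIV :: (nat \<times> nat) set"
    by unfold_locales
  have "AE \<xi> in PiM UNIV (\<lambda>_::nat\<times>nat. measure_pmf p). P (\<xi> i)" for i
    by (rule AE_component) (auto simp: AE_measure_pmf_iff assms)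
  then show ?thesis unfolding offspring_space_def by (subst AE_all_countable) auto
qed

section \<open>One branching-selection step\<close>

definition advance :: "nat \<Rightarrow> (nat \<Rightarrow> nat) \<Rightarrow> int list \<Rightarrow> int list" where
  "advance N x ys = keep_rightmost N (branch x ys)"

text \<open>Tail counts turn selection into \<open>min N\<close>, so the sorted list never has to be
  examined further.\<close>

definition count_ge :: "int \<Rightarrow> int list \<Rightarrow> nat" where
  "count_ge z ys = length (filter (\<lambda>y. z \<le> y) ys)"

text \<open>Indices are kept instead of a number because the draws are attached to indices: disjoint
  sites read independent draws.\<close>

definition sites :: "int \<Rightarrow> int list \<Rightarrow> nat set" where
  "sites z ys = {i. i < length ys \<and> ys ! i = z}"

definition top_pos :: "int list \<Rightarrow> int" where
  "top_pos ys = Max (set ys)"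

definition leaders :: "int list \<Rightarrow> nat" where
  "leaders ys = count_ge (top_pos ys) ys"

definition followers :: "int list \<Rightarrow> nat" where
  "followers ys = card (sites (top_pos ys - 1) ys)"

lemma finite_sites [simp]: "finite (sites z ys)"
  by (simp add: sites_def)

lemma count_ge_conv_sum: "count_ge z ys = (\<Sum>i<length ys. if z \<le> ys ! i then 1 else 0)"
  by (simp add: count_ge_def length_filter_conv_card sum.If_cases Collect_conj_eq lessThan_def)

lemma count_ge_Cons: "count_ge z (y # ys) = (if z \<le> y then 1 else 0) + count_ge z ys"
  by (simp add: count_ge_def)

lemma count_ge_le_length: "count_ge z ys \<le> length ys"
  by (simp add: count_ge_def)

lemma count_ge_split: "count_ge z ys = count_ge (z + 1) ys + card (sites z ys)"
proof -
  have "card (sites z ys) = (\<Sum>i<length ys. if ys ! i = z then 1 else 0)"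
    by (simp add: sites_def sum.If_cases Collect_conj_eq lessThan_def)
  then show ?thesis
    unfolding count_ge_conv_sum by (simp add: sum.distrib[symmetric], intro sum.cong) auto
qed

text \<open>Both children of a particle at or above \<open>z\<close> remain there whatever they do,
  so the draws matter only at site \<open>z - 1\<close>. The bound on \<open>x\<close> makes the two
  \<open>replicate\<close> lengths add up to exactly 2.\<close>

lemma count_ge_branch:
  assumes "\<And>i. i < length ys \<Longrightarrow> x i \<le> 2"
  shows "count_ge z (branch x ys) = 2 * count_ge z ys + (\<Sum>i\<in>sites (z - 1) ys. x i)"
proof -
  have "count_ge z (branch x ys) =
      (\<Sum>i<length ys. (if z \<le> ys ! i + 1 then x i else 0) + (if z \<le> ys ! i then 2 - x i else 0))"
    unfolding count_ge_def branch_def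
    by (auto simp: filter_concat length_concat comp_def interv_sum_list_conv_sum_set_nat
        atLeast0LessThan intro!: sum.cong)
  also have "\<dots> = (\<Sum>i<length ys. 2 * (if z \<le> ys ! i then 1 else 0) + (if ys ! i = z - 1 then x i else 0))"
    using assms by (intro sum.cong) (auto simp: le_less)
  also have "\<dots> = 2 * count_ge z ys + (\<Sum>i<length ys. if ys ! i = z - 1 then x i else 0)"
    by (simp add: count_ge_conv_sum sum.distrib sum_distrib_left)
  also have "(\<Sum>i<length ys. if ys ! i = z - 1 then x i else 0) = (\<Sum>i\<in>sites (z - 1) ys. x i)"
    by (simp add: sites_def sum.If_cases Collect_conj_eq lessThan_def)
  finally show ?thesis .
qed

text \<open>In a descending list the entries at or above \<open>z\<close> form a prefix.\<close>

lemma count_ge_take_descending: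
  "sorted_wrt (\<ge>) l \<Longrightarrow> count_ge z (take N l) = min N (count_ge z l)"
proof (induction l arbitrary: N)
  case (Cons a l)
  have "count_ge z l = 0" if "\<not> z \<le> a"
    using Cons.prems that by (auto simp: count_ge_def filter_empty_conv)
  moreover have "count_ge z (take n l) \<le> count_ge z l" for n
    using Cons by (auto)
  ultimately show ?case using Cons by (cases N) (auto simp: count_ge_Cons count_ge_def[of _ "[]"])
qed (simp add: count_ge_def)

lemma count_ge_keep_rightmost: "count_ge z (keep_rightmost N l) = min N (count_ge z l)"
proof -
  have "sorted_wrt (\<ge>) (rev (sort l))"
    by (simp add: sorted_wrt_rev)
  moreover have "count_ge z (rev (sort l)) = count_ge z l"
    unfolding count_ge_def by (metis mset_filter mset_rev mset_sort size_mset)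
  ultimately show ?thesis
    by (simp add: keep_rightmost_def count_ge_take_descending)
qed

lemma count_ge_advance:
  assumes "\<And>i. i < length ys \<Longrightarrow> x i \<le> 2"
  shows "count_ge z (advance N x ys) = min N (2 * count_ge z ys + (\<Sum>i\<in>sites (z - 1) ys. x i))"
  using assms by (simp add: advance_def count_ge_keep_rightmost count_ge_branch)

text \<open>With truncated subtraction \<open>x i + (2 - x i)\<close> is at least 2 for every
  \<open>x\<close>, so selection always finds \<open>N\<close> particles.\<close>

lemma length_branch_ge: "2 * length ys \<le> length (branch x ys)"
proof -
  have "(\<Sum>i<length ys. 2) \<le> (\<Sum>i<length ys. x i + (2 - x i))"
    by (intro sum_mono) auto
  then show ?thesis
    by (simp add: branch_def length_concat comp_def interv_sum_list_conv_sum_set_nat atLeast0LessThan)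
qed

lemma length_advance [simp]: "length ys = N \<Longrightarrow> length (advance N x ys) = N"
  using length_branch_ge[of ys x] by (simp add: advance_def keep_rightmost_def)

lemma branch_cong: "(\<And>i. i < length ys \<Longrightarrow> x i = x' i) \<Longrightarrow> branch x ys = branch x' ys"
  unfolding branch_def by (intro arg_cong[where f = concat] map_cong) auto

lemma count_ge_pos_iff: "0 < count_ge z ys \<longleftrightarrow> (\<exists>y\<in>set ys. z \<le> y)"
  by (auto simp: count_ge_def filter_empty_conv)

lemma top_pos_ge_iff: "ys \<noteq> [] \<Longrightarrow> z \<le> top_pos ys \<longleftrightarrow> 0 < count_ge z ys"
  by (simp add: count_ge_pos_iff top_pos_def Max_ge_iff)

lemma count_ge_above_top: "ys \<noteq> [] \<Longrightarrow> top_pos ys < z \<Longrightarrow> count_ge z ys = 0"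
  using top_pos_ge_iff[of ys z] by simp

lemma leaders_pos: "ys \<noteq> [] \<Longrightarrow> 0 < leaders ys"
  using top_pos_ge_iff[of ys "top_pos ys"] by (simp add: leaders_def)

lemma leaders_eq_card_sites: "ys \<noteq> [] \<Longrightarrow> leaders ys = card (sites (top_pos ys) ys)"
  by (simp add: leaders_def count_ge_split[of "top_pos ys"] count_ge_above_top)

lemma count_ge_top_pos_minus: "count_ge (top_pos ys - 1) ys = leaders ys + followers ys"
  using count_ge_split[of "top_pos ys - 1" ys] by (simp add: leaders_def followers_def)

lemma leaders_followers_le: "leaders ys + followers ys \<le> length ys"
  unfolding count_ge_top_pos_minus[symmetric] by (rule count_ge_le_length)

lemma top_pos_eqI: "ys \<noteq> [] \<Longrightarrow> 0 < count_ge z ys \<Longrightarrow> count_ge (z + 1) ys = 0 \<Longrightarrow> top_pos ys = z"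
  using top_pos_ge_iff[of ys z] top_pos_ge_iff[of ys "z + 1"] by simp

context
  fixes N :: nat and x :: "nat \<Rightarrow> nat" and ys :: "int list"
  assumes N: "0 < N" and len: "length ys = N" and x: "\<And>i. i < N \<Longrightarrow> x i \<le> 2"
begin

lemma nonempty: "ys \<noteq> []" "advance N x ys \<noteq> []"
proof -
  have "length (advance N x ys) \<noteq> 0" using N len by simp
  then show "advance N x ys \<noteq> []" by auto
qed (use N len in auto)

lemma sites_above_top: "top_pos ys < z \<Longrightarrow> sites z ys = {}"
proof -
  assume "top_pos ys < z"
  moreover have "ys ! i \<le> top_pos ys" if "i < length ys" for i
    using that by (simp add: top_pos_def)
  ultimately show ?thesis by (force simp: sites_def)
qed

lemma count_ge_advance_top:
  "count_ge (top_pos ys + 2) (advance N x ys) = 0"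
  "count_ge (top_pos ys + 1) (advance N x ys) = min N (\<Sum>i\<in>sites (top_pos ys) ys. x i)"
  "count_ge (top_pos ys) (advance N x ys) =
     min N (2 * leaders ys + (\<Sum>i\<in>sites (top_pos ys - 1) ys. x i))"
proof -
  have *: "count_ge z (advance N x ys) = min N (2 * count_ge z ys + (\<Sum>i\<in>sites (z - 1) ys. x i))" for z
    by (rule count_ge_advance) (use x len in auto)
  show "count_ge (top_pos ys + 2) (advance N x ys) = 0"
    "count_ge (top_pos ys + 1) (advance N x ys) = min N (\<Sum>i\<in>sites (top_pos ys) ys. x i)"
    "count_ge (top_pos ys) (advance N x ys) =
       min N (2 * leaders ys + (\<Sum>i\<in>sites (top_pos ys - 1) ys. x i))"
    unfolding * using count_ge_above_top[OF nonempty(1)] sites_above_top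
    by (simp_all add: leaders_def)
qed

text \<open>After a move the old top is the second site. The new two front sites therefore hold
  everything at or above the old top: both children of every leader and the children that join from
  one site below, cut off at \<open>N\<close>.\<close>

lemma advance_success:
  assumes B: "(\<Sum>i\<in>sites (top_pos ys) ys. x i) \<noteq> 0"
  shows "top_pos (advance N x ys) = top_pos ys + 1"
    and "leaders (advance N x ys) = min N (\<Sum>i\<in>sites (top_pos ys) ys. x i)"
    and "leaders (advance N x ys) + followers (advance N x ys) =
         min N (2 * leaders ys + (\<Sum>i\<in>sites (top_pos ys - 1) ys. x i))"
proof -
  show *: "top_pos (advance N x ys) = top_pos ys + 1"
    by (rule top_pos_eqI)
      (use nonempty N B count_ge_advance_top in \<open>simp_all add: add.assoc del: sum_eq_0_iff\<close>)
  show "leaders (advance N x ys) = min N (\<Sum>i\<in>sites (top_pos ys) ys. x i)"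
    by (simp add: leaders_def * count_ge_advance_top)
  show "leaders (advance N x ys) + followers (advance N x ys) =
         min N (2 * leaders ys + (\<Sum>i\<in>sites (top_pos ys - 1) ys. x i))"
    using count_ge_top_pos_minus[of "advance N x ys"] by (simp add: * count_ge_advance_top)
qed

lemma advance_failure:
  assumes B: "(\<Sum>i\<in>sites (top_pos ys) ys. x i) = 0"
  shows "top_pos (advance N x ys) = top_pos ys"
    and "leaders (advance N x ys) = min N (2 * leaders ys + (\<Sum>i\<in>sites (top_pos ys - 1) ys. x i))"
proof -
  show *: "top_pos (advance N x ys) = top_pos ys"
    by (rule top_pos_eqI) (use nonempty N B count_ge_advance_top leaders_pos[OF nonempty(1)] in auto)
  show "leaders (advance N x ys) = min N (2 * leaders ys + (\<Sum>i\<in>sites (top_pos ys - 1) ys. x i))"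
    by (simp add: leaders_def[of "advance N x ys"] * count_ge_advance_top)
qed

lemma leaders_advance_ge: "min N (\<Sum>i\<in>sites (top_pos ys) ys. x i) \<le> leaders (advance N x ys)"
  by (cases "(\<Sum>i\<in>sites (top_pos ys) ys. x i) = 0") (simp_all add: advance_success)

lemma front_advance_ge:
  "min N (2 * leaders ys + (\<Sum>i\<in>sites (top_pos ys - 1) ys. x i))
     \<le> leaders (advance N x ys) + followers (advance N x ys)"
proof (cases "(\<Sum>i\<in>sites (top_pos ys) ys. x i) = 0")
  case True
  then show ?thesis by (simp add: advance_failure)
next
  case False
  from advance_success(3)[OF this] show ?thesis by simp
qed

end

lemma top_pos_advance_bounds:
  assumes "0 < N" "length ys = N" "\<And>i. i < N \<Longrightarrow> x i \<le> 2"
  shows "top_pos ys \<le> top_pos (advance N x ys)" "top_pos (advance N x ys) \<le> top_pos ys + 1"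
  using advance_success(1)[OF assms(1,2), of x] advance_failure(1)[OF assms(1,2), of x] assms(3)
  by (cases "(\<Sum>i\<in>sites (top_pos ys) ys. x i) = 0"; simp del: sum_eq_0_iff)+

section \<open>Translation invariance and coalescence\<close>

lemma advance_shift:
  "advance N x (map (\<lambda>y. y + c) ys) = map (\<lambda>y. y + c) (advance N x ys)"
proof -
  have "branch x (map (\<lambda>y. y + c) ys) = map (\<lambda>y. y + c) (branch x ys)"
    unfolding branch_def map_concat by (auto intro!: arg_cong[where f = concat] simp: algebra_simps)
  moreover have "sort (map (\<lambda>y. y + c) l) = map (\<lambda>y. y + c) (sort l)" for l :: "int list"
  proof (rule properties_for_sort)
    have "sorted_wrt (\<lambda>a b. a + c \<le> b + c) (sort l)"
      by (rule sorted_wrt_mono_rel[OF _ sorted_sort]) auto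
    then show "sorted (map (\<lambda>y. y + c) (sort l))" by (simp add: sorted_wrt_map)
  qed simp
  ultimately show ?thesis
    by (simp add: advance_def keep_rightmost_def rev_map take_map)
qed

lemma top_pos_shift: "ys \<noteq> [] \<Longrightarrow> top_pos (map (\<lambda>y. y + c) ys) = top_pos ys + c"
  by (simp add: top_pos_def Max_add_commute image_comp comp_def)

lemma top_pos_replicate: "0 < N \<Longrightarrow> top_pos (replicate N c) = c"
  by (simp add: top_pos_def)

lemma leaders_replicate: "0 < N \<Longrightarrow> leaders (replicate N c) = N"
  by (simp add: leaders_def top_pos_replicate count_ge_def)

lemma sum_sites_constant: "length ys = N \<Longrightarrow> (\<Sum>i\<in>sites z ys. if i < N then c else 0) = c * card (sites z ys)"
  for c :: nat
proof -
  assume "length ys = N"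
  then have "(\<Sum>i\<in>sites z ys. if i < N then c else 0) = (\<Sum>i\<in>sites z ys. c)"
    by (intro sum.cong) (auto simp: sites_def)
  then show ?thesis by simp
qed

text \<open>If every child jumps, the number of leaders doubles at each step until it reaches
  \<open>N\<close>; the final configuration then depends on the start only through the position of
  its top.\<close>

lemma advance_all_right_replicate:
  assumes N: "0 < N" "N \<le> 2 ^ n" and len: "length ys = N"
  shows "(advance N (\<lambda>i. if i < N then 2 else 0) ^^ n) ys = replicate N (top_pos ys + int n)"
proof -
  let ?x = "\<lambda>i. if i < N then 2 else 0 :: nat"
  have main: "length ((advance N ?x ^^ j) ys) = N \<and> top_pos ((advance N ?x ^^ j) ys) = top_pos ys + int j \<and>
      min N (2 ^ j) \<le> leaders ((advance N ?x ^^ j) ys)" for j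
  proof (induction j)
    case 0
    then show ?case using leaders_pos[of ys] len N by auto
  next
    case (Suc j)
    let ?y = "(advance N ?x ^^ j) ys"
    have l: "length ?y = N" and ne: "?y \<noteq> []" and x: "\<And>i. i < N \<Longrightarrow> ?x i \<le> 2" using Suc N by auto
    have B: "(\<Sum>i\<in>sites (top_pos ?y) ?y. ?x i) = 2 * leaders ?y"
      using sum_sites_constant[OF l] leaders_eq_card_sites[OF ne] by simp
    have "(\<Sum>i\<in>sites (top_pos ?y) ?y. ?x i) \<noteq> 0" using leaders_pos[OF ne] B by simp
    from advance_success[OF N(1) l x this] Suc l B show ?case by auto
  qed
  let ?y = "(advance N ?x ^^ n) ys"
  obtain zs where zs: "zs = ?y" by simp
  have len': "length zs = N" and top: "top_pos zs = top_pos ys + int n" and "N \<le> leaders zs"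
    using main[of n] N by (auto simp: zs)
  then have "length (filter (\<lambda>y. top_pos zs \<le> y) zs) = length zs"
    using count_ge_le_length[of "top_pos zs" zs] by (simp add: leaders_def count_ge_def)
  then have "\<forall>y\<in>set zs. top_pos zs \<le> y"
    using length_filter_less[of _ zs "\<lambda>y. top_pos zs \<le> y"] by force
  moreover have "\<forall>y\<in>set zs. y \<le> top_pos zs" by (simp add: top_pos_def)
  ultimately have "\<forall>y\<in>set zs. y = top_pos ys + int n" using top by force
  then show ?thesis using len' replicate_length_same[of zs "top_pos ys + int n"] by (simp add: zs)
qed

section \<open>Transition operators and the offspring law\<close>

text \<open>\<open>S\<close> is an invariant set of admissible states: inequalities between
  functions are required only there and still pass through the iterated operator.\<close>

locale markov_step =
  fixes p :: "nat pmf" and m :: nat and F :: "(nat \<Rightarrow> nat) \<Rightarrow> 'a \<Rightarrow> 'a" and S :: "'a set"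
  assumes finite_support: "finite (set_pmf p)"
    and closed: "x \<in> set_pmf (draws p m) \<Longrightarrow> z \<in> S \<Longrightarrow> F x z \<in> S"
begin

abbreviation "T \<equiv> transition p m F"

lemma integrable_draws: "integrable (measure_pmf (draws p m)) (f :: _ \<Rightarrow> real)"
  by (intro integrable_measure_pmf_finite finite_set_draws finite_support)

lemma expectation_draws_mono:
  fixes f g :: "(nat \<Rightarrow> nat) \<Rightarrow> real"
  assumes "\<And>x. x \<in> set_pmf (draws p m) \<Longrightarrow> f x \<le> g x"
  shows "measure_pmf.expectation (draws p m) f \<le> measure_pmf.expectation (draws p m) g"
  using assms by (intro integral_mono_AE integrable_draws) (auto simp: AE_measure_pmf_iff)

lemma transition_add: "T (\<lambda>z. f z + g z) z = T f z + T g z"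
  unfolding transition_def by (simp add: integrable_draws)

lemma transition_diff: "T (\<lambda>z. f z - g z) z = T f z - T g z"
  unfolding transition_def by (simp add: integrable_draws)

lemma transition_cmult: "T (\<lambda>z. c * f z) z = c * T f z"
  unfolding transition_def by simp

lemma transition_const [simp]: "T (\<lambda>_. c) = (\<lambda>_. c)"
  by (simp add: transition_def fun_eq_iff)

lemma transition_mono: "z \<in> S \<Longrightarrow> (\<And>z. z \<in> S \<Longrightarrow> f z \<le> g z) \<Longrightarrow> T f z \<le> T g z"
  unfolding transition_def using closed by (intro expectation_draws_mono) auto

lemma iter_add: "(T ^^ k) (\<lambda>z. f z + g z) z = (T ^^ k) f z + (T ^^ k) g z"
proof (induction k arbitrary: z)
  case (Suc k)
  then have "(T ^^ k) (\<lambda>z. f z + g z) = (\<lambda>z. (T ^^ k) f z + (T ^^ k) g z)" by blast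
  then show ?case by (simp add: transition_add)
qed simp

lemma iter_diff: "(T ^^ k) (\<lambda>z. f z - g z) z = (T ^^ k) f z - (T ^^ k) g z"
proof (induction k arbitrary: z)
  case (Suc k)
  then have "(T ^^ k) (\<lambda>z. f z - g z) = (\<lambda>z. (T ^^ k) f z - (T ^^ k) g z)" by blast
  then show ?case by (simp add: transition_diff)
qed simp

lemma iter_cmult: "(T ^^ k) (\<lambda>z. c * f z) z = c * (T ^^ k) f z"
proof (induction k arbitrary: z)
  case (Suc k)
  then have "(T ^^ k) (\<lambda>z. c * f z) = (\<lambda>z. c * (T ^^ k) f z)" by blast
  then show ?case by (simp add: transition_cmult)
qed simp

lemma iter_const [simp]: "(T ^^ k) (\<lambda>_. c) = (\<lambda>_. c)"
  by (induction k) simp_all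

lemma iter_mono: "z \<in> S \<Longrightarrow> (\<And>z. z \<in> S \<Longrightarrow> f z \<le> g z) \<Longrightarrow> (T ^^ k) f z \<le> (T ^^ k) g z"
  by (induction k arbitrary: z) (auto intro: transition_mono)

lemma iter_Suc': "(T ^^ Suc k) f = (T ^^ k) (T f)"
  by (simp add: funpow_swap1)

lemma iter_plus: "(T ^^ (j + k)) f = (T ^^ j) ((T ^^ k) f)"
  by (simp add: funpow_add)

text \<open>Each summand is the difference of two consecutive iterates. For bounded \<open>f\<close>
  the total stays bounded in \<open>k\<close>, hence disappears in the time average.\<close>

lemma sum_iter_telescope:
  "(\<Sum>j<k. (T ^^ j) (\<lambda>z. f z - T f z) z) = f z - (T ^^ k) f z"
  by (induction k) (simp_all add: iter_diff funpow_swap1)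

text \<open>The bound is the fixed point of the map sending \<open>x\<close> to
  \<open>\<rho> * x + c\<close>. The inhomogeneity \<open>h\<close> is controlled only in mean
  because in \<open>iter_front_le\<close> it contains \<open>q \<alpha> ^ leaders ys\<close>, which
  is not small when there are few leaders.\<close>

lemma iter_drift_bound:
  assumes z0: "z0 \<in> S" and \<rho>: "0 \<le> \<rho>" "\<rho> < 1"
    and drift: "\<And>z. z \<in> S \<Longrightarrow> T f z \<le> \<rho> * f z + h z"
    and h: "\<And>j. (T ^^ j) h z0 \<le> c" and init: "f z0 \<le> c / (1 - \<rho>)"
  shows "(T ^^ k) f z0 \<le> c / (1 - \<rho>)"
proof (induction k)
  case (Suc k)
  have "(T ^^ Suc k) f z0 \<le> (T ^^ k) (\<lambda>z. \<rho> * f z + h z) z0"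
    unfolding iter_Suc' by (rule iter_mono[where f = "T f" and g = "\<lambda>z. \<rho> * f z + h z", OF z0 drift])
  also have "\<dots> = \<rho> * (T ^^ k) f z0 + (T ^^ k) h z0"
    by (simp only: iter_add[of k "\<lambda>z. \<rho> * f z" h] iter_cmult)
  also have "\<dots> \<le> \<rho> * (c / (1 - \<rho>)) + c"
    by (intro add_mono mult_left_mono Suc h \<rho>)
  also have "\<dots> = c / (1 - \<rho>)" using \<rho> by (simp add: field_simps)
  finally show ?case .
qed (use init in simp)

end

section \<open>The generating function of the offspring law\<close>

locale supercritical =
  fixes \<alpha> :: real
  assumes \<alpha>_gt: "1 / 2 < \<alpha>" and \<alpha>_lt: "\<alpha> < 1"
begin

definition pgf :: "real \<Rightarrow> real" where "pgf s = (1 - \<alpha> + \<alpha> * s)\<^sup>2"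

text \<open>The discriminant is the square of \<open>2 * \<alpha> - 1\<close>, and
  \<open>\<alpha> > 1/2\<close> decides the sign of its root.\<close>

lemma q_eq: "q \<alpha> = ((1 - \<alpha>) / \<alpha>)\<^sup>2"
proof -
  have "1 - 4 * \<alpha> * (1 - \<alpha>) = (2 * \<alpha> - 1)\<^sup>2" by (simp add: power2_eq_square algebra_simps)
  then have "sqrt (1 - 4 * \<alpha> * (1 - \<alpha>)) = 2 * \<alpha> - 1" using \<alpha>_gt by simp
  then show ?thesis using \<alpha>_gt unfolding q_def by (simp add: power2_eq_square divide_simps) (simp add: algebra_simps)
qed

lemma q_pos: "0 < q \<alpha>" and q_less_1: "q \<alpha> < 1"
proof -
  have "0 < (1 - \<alpha>) / \<alpha>" "(1 - \<alpha>) / \<alpha> < 1" using \<alpha>_gt \<alpha>_lt by (auto simp: field_simps)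
  then show "0 < q \<alpha>" "q \<alpha> < 1" unfolding q_eq by (auto simp: power_less_one_iff)
qed

text \<open>The quadratic \<open>pgf s - s\<close> has the roots 1 and \<open>q \<alpha>\<close>.
  The factorisation yields both fixed points and, from its sign, the contraction strictly between
  them.\<close>

lemma pgf_diff: "pgf s - s = \<alpha>\<^sup>2 * (s - 1) * (s - q \<alpha>)"
proof -
  have "\<alpha>\<^sup>2 * q \<alpha> = (1 - \<alpha>)\<^sup>2" using \<alpha>_gt by (simp add: q_eq power_divide)
  moreover have "\<alpha>\<^sup>2 * (s - 1) * (s - q \<alpha>) = \<alpha>\<^sup>2 * (s - 1) * s - (s - 1) * (\<alpha>\<^sup>2 * q \<alpha>)"
    by algebra
  ultimately have "\<alpha>\<^sup>2 * (s - 1) * (s - q \<alpha>) = \<alpha>\<^sup>2 * (s - 1) * s - (s - 1) * (1 - \<alpha>)\<^sup>2"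
    by simp
  moreover have "pgf s - s = \<alpha>\<^sup>2 * (s - 1) * s - (s - 1) * (1 - \<alpha>)\<^sup>2"
    unfolding pgf_def by algebra
  ultimately show ?thesis by simp
qed

lemma pgf_q: "pgf (q \<alpha>) = q \<alpha>"
  using pgf_diff[of "q \<alpha>"] by simp

lemma pgf_1 [simp]: "pgf 1 = 1" by (simp add: pgf_def)

lemma pgf_nonneg [simp]: "0 \<le> pgf s" by (simp add: pgf_def)

lemma pgf_less: "q \<alpha> < s \<Longrightarrow> s < 1 \<Longrightarrow> pgf s < s"
proof -
  assume "q \<alpha> < s" "s < 1"
  then have "0 < \<alpha>\<^sup>2 * (1 - s) * (s - q \<alpha>)" using \<alpha>_gt by simp
  then show "pgf s < s" using pgf_diff[of s] by (simp add: algebra_simps)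
qed

lemma pgf_mono: "0 \<le> s \<Longrightarrow> s \<le> t \<Longrightarrow> pgf s \<le> pgf t"
  unfolding pgf_def using \<alpha>_gt \<alpha>_lt by (intro power_mono add_mono mult_left_mono) auto

text \<open>This keeps \<open>pgf t\<close> inside the contraction range, so that
  \<open>iter_leaders_le\<close> can be used at \<open>pgf t\<close> in the lower bound on the
  deficit.\<close>

lemma pgf_gt_q: assumes "q \<alpha> < s" shows "q \<alpha> < pgf s"
proof -
  have "1 - \<alpha> + \<alpha> * q \<alpha> < 1 - \<alpha> + \<alpha> * s" using assms \<alpha>_gt by simp
  moreover have "0 \<le> 1 - \<alpha> + \<alpha> * q \<alpha>" using \<alpha>_gt \<alpha>_lt q_pos by simp
  ultimately have "pgf (q \<alpha>) < pgf s" unfolding pgf_def by (intro power_strict_mono) auto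
  then show ?thesis by (simp add: pgf_q)
qed

abbreviation "offspring \<equiv> binomial_pmf 2 \<alpha>"

lemma set_offspring: "set_pmf offspring = {..2}"
  using \<alpha>_gt \<alpha>_lt by (simp add: set_pmf_binomial)

lemma expectation_offspring_power: "measure_pmf.expectation offspring (\<lambda>n. s ^ n) = pgf s"
proof -
  have set: "set_pmf offspring = {0, 1, 2}" unfolding set_offspring by auto
  have pmf: "pmf offspring 0 = (1 - \<alpha>)\<^sup>2" "pmf offspring 1 = 2 * \<alpha> * (1 - \<alpha>)" "pmf offspring 2 = \<alpha>\<^sup>2"
    using \<alpha>_gt \<alpha>_lt by simp_all
  have "measure_pmf.expectation offspring (\<lambda>n. s ^ n) = (\<Sum>n\<in>{0, 1, 2}. s ^ n * pmf offspring n)"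
    by (rule integral_measure_pmf_real) (simp_all only: set finite.intros)
  also have "\<dots> = (1 - \<alpha>)\<^sup>2 + (s * (2 * \<alpha> * (1 - \<alpha>)) + s\<^sup>2 * \<alpha>\<^sup>2)"
    using pmf by simp
  also have "\<dots> = pgf s"
    unfolding pgf_def by algebra
  finally show ?thesis .
qed

lemma draws_le: "x \<in> set_pmf (draws offspring m) \<Longrightarrow> x i \<le> 2"
  using set_Pi_pmf_subset'[of "{..<m}" 0 "\<lambda>_. offspring"]
  by (cases "i < m") (force simp: draws_def PiE_dflt_def set_offspring)+

lemma expectation_draws_power_sum:
  assumes "A \<subseteq> {..<m}" "B \<subseteq> {..<m}" "A \<inter> B = {}" "0 \<le> s" "0 \<le> t"
  shows "measure_pmf.expectation (draws offspring m) (\<lambda>x. s ^ (\<Sum>i\<in>A. x i) * t ^ (\<Sum>i\<in>B. x i))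
       = pgf s ^ card A * pgf t ^ card B"
proof -
  \<comment> \<open>Weights \<open>s\<close> on \<open>A\<close>, \<open>t\<close> on
    \<open>B\<close> and 1 elsewhere merge the two powers into one product over all coordinates. The
    same splitting rule is used twice: for powers of the weights before integration, and for their
    generating functions after it.\<close>
  define w where "w i = (if i \<in> A then s else if i \<in> B then t else 1)" for i
  have split: "(\<Prod>i<m. f (w i) i) = (\<Prod>i\<in>A. f s i) * (\<Prod>i\<in>B. f t i)"
    if "\<And>i. f 1 i = 1" for f :: "real \<Rightarrow> nat \<Rightarrow> real"
  proof -
    have fin: "finite A" "finite B" using assms finite_subset by blast+
    have "(\<Prod>i<m. f (w i) i) = (\<Prod>i\<in>A \<union> B. f (w i) i)"
    proof (rule prod.mono_neutral_right)
      show "\<forall>i\<in>{..<m} - (A \<union> B). f (w i) i = 1"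
        by (simp add: w_def that)
    qed (use assms in auto)
    also have "\<dots> = (\<Prod>i\<in>A. f (w i) i) * (\<Prod>i\<in>B. f (w i) i)"
      using fin assms by (intro prod.union_disjoint) auto
    also have "\<dots> = (\<Prod>i\<in>A. f s i) * (\<Prod>i\<in>B. f t i)"
    proof -
      have "(\<Prod>i\<in>A. f (w i) i) = (\<Prod>i\<in>A. f s i)" by (rule prod.cong) (simp_all add: w_def)
      moreover have "(\<Prod>i\<in>B. f (w i) i) = (\<Prod>i\<in>B. f t i)"
        by (rule prod.cong) (use assms(3) in \<open>auto simp: w_def\<close>)
      ultimately show ?thesis by simp
    qed
    finally show ?thesis .
  qed
  have "(\<lambda>x. s ^ (\<Sum>i\<in>A. x i) * t ^ (\<Sum>i\<in>B. x i)) = (\<lambda>x. \<Prod>i<m. w i ^ x i)"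
  proof
    fix x :: "nat \<Rightarrow> nat"
    show "s ^ (\<Sum>i\<in>A. x i) * t ^ (\<Sum>i\<in>B. x i) = (\<Prod>i<m. w i ^ x i)"
      using split[of "\<lambda>u i. u ^ x i"] by (simp add: power_sum)
  qed
  then have "measure_pmf.expectation (draws offspring m) (\<lambda>x. s ^ (\<Sum>i\<in>A. x i) * t ^ (\<Sum>i\<in>B. x i))
      = (\<Prod>i<m. measure_pmf.expectation offspring (\<lambda>n. w i ^ n))"
    unfolding draws_def using assms
    by (simp, intro expectation_prod_Pi_pmf) (auto simp: w_def set_offspring intro!: integrable_measure_pmf_finite)
  also have "\<dots> = pgf s ^ card A * pgf t ^ card B"
    using split[of "\<lambda>u i. pgf u"] by (simp add: expectation_offspring_power)
  finally show ?thesis .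
qed

end

section \<open>Drift estimates for the leaders\<close>

locale bbs_process = supercritical +
  fixes N :: nat
  assumes N: "0 < N"
begin

sublocale markov_step "binomial_pmf 2 \<alpha>" N "advance N" "{ys. length ys = N}"
  by unfold_locales (auto simp: set_offspring)

definition origin :: "int list" where "origin = replicate N 0"

lemma length_origin [simp]: "length origin = N" by (simp add: origin_def)

lemma leaders_origin [simp]: "leaders origin = N" using N by (simp add: origin_def leaders_replicate)

lemma followers_origin [simp]: "followers origin = 0"
  using leaders_followers_le[of origin] by simp

lemma top_pos_origin [simp]: "top_pos origin = 0" using N by (simp add: origin_def top_pos_replicate)

abbreviation height :: "int list \<Rightarrow> real" where "height ys \<equiv> real_of_int (top_pos ys)"

definition movers :: "int list \<Rightarrow> (nat \<Rightarrow> nat) \<Rightarrow> nat" where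
  "movers ys x = (\<Sum>i\<in>sites (top_pos ys) ys. x i)"

definition joiners :: "int list \<Rightarrow> (nat \<Rightarrow> nat) \<Rightarrow> nat" where
  "joiners ys x = (\<Sum>i\<in>sites (top_pos ys - 1) ys. x i)"

lemma expectation_movers_joiners:
  assumes "length ys = N" "0 \<le> s" "0 \<le> t"
  shows "measure_pmf.expectation (draws offspring N) (\<lambda>x. s ^ movers ys x * t ^ joiners ys x)
     = pgf s ^ leaders ys * pgf t ^ followers ys"
proof -
  have "ys \<noteq> []" using assms N by auto
  have sub: "sites z ys \<subseteq> {..<N}" for z using assms(1) by (auto simp: sites_def)
  have disj: "sites (top_pos ys) ys \<inter> sites (top_pos ys - 1) ys = {}" by (auto simp: sites_def)
  show ?thesis
    unfolding movers_def joiners_def leaders_eq_card_sites[OF \<open>ys \<noteq> []\<close>] followers_def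
    using expectation_draws_power_sum[OF sub[of "top_pos ys"] sub[of "top_pos ys - 1"] disj assms(2,3)] .
qed

lemma expectation_movers:
  assumes "length ys = N" "0 \<le> s"
  shows "measure_pmf.expectation (draws offspring N) (\<lambda>x. s ^ movers ys x) = pgf s ^ leaders ys"
  using expectation_movers_joiners[of ys s 1] assms by simp

context
  fixes ys :: "int list" and x :: "nat \<Rightarrow> nat"
  assumes ys: "length ys = N" and x: "x \<in> set_pmf (draws offspring N)"
begin

lemma leaders_step_ge: "min N (movers ys x) \<le> leaders (advance N x ys)"
  unfolding movers_def by (rule leaders_advance_ge[OF N ys]) (use draws_le[OF x] in auto)

lemma front_step_ge:
  "min N (2 * leaders ys + joiners ys x) \<le> leaders (advance N x ys) + followers (advance N x ys)"
  unfolding joiners_def by (rule front_advance_ge[OF N ys]) (use draws_le[OF x] in auto)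

lemma step_cases:
  obtains (success) "movers ys x \<noteq> 0" "top_pos (advance N x ys) = top_pos ys + 1"
      "leaders (advance N x ys) = min N (movers ys x)"
  | (failure) "movers ys x = 0" "top_pos (advance N x ys) = top_pos ys"
      "leaders (advance N x ys) = min N (2 * leaders ys + joiners ys x)"
proof -
  have x2: "\<And>i. i < N \<Longrightarrow> x i \<le> 2" by (rule draws_le[OF x])
  show thesis
  proof (cases "movers ys x = 0")
    case True
    then have *: "(\<Sum>i\<in>sites (top_pos ys) ys. x i) = 0" by (simp only: movers_def)
    have "top_pos (advance N x ys) = top_pos ys"
      by (rule advance_failure(1)[OF N ys]) (use x2 * in auto)
    moreover have "leaders (advance N x ys) = min N (2 * leaders ys + joiners ys x)"
      unfolding joiners_def by (rule advance_failure(2)[OF N ys]) (use x2 * in auto)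
    ultimately show ?thesis using True by (intro failure)
  next
    case False
    then have *: "(\<Sum>i\<in>sites (top_pos ys) ys. x i) \<noteq> 0" unfolding movers_def .
    have "top_pos (advance N x ys) = top_pos ys + 1"
      by (rule advance_success(1)[OF N ys]) (use x2 * in auto)
    moreover have "leaders (advance N x ys) = min N (movers ys x)"
      unfolding movers_def by (rule advance_success(2)[OF N ys]) (use x2 * in auto)
    ultimately show ?thesis using False by (intro success)
  qed
qed

end

text \<open>\<open>s ^ n\<close> is at most \<open>s ^ min a b\<close>, which is one of the two
  summands. The selection cutoff at \<open>N\<close> thereby becomes an additive error instead of a
  case distinction.\<close>

lemma power_min_le: "0 \<le> s \<Longrightarrow> s \<le> 1 \<Longrightarrow> min a b \<le> n \<Longrightarrow> s ^ n \<le> s ^ a + s ^ b" for s :: real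
  by (cases "a \<le> b") (auto intro: order_trans[OF power_decreasing] add_increasing add_increasing2)

lemma transition_leaders_le:
  assumes ys: "length ys = N" and s: "0 \<le> s" "s \<le> 1"
  shows "T (\<lambda>ys. s ^ leaders ys) ys \<le> pgf s ^ leaders ys + s ^ N"
proof -
  have "T (\<lambda>ys. s ^ leaders ys) ys
      \<le> measure_pmf.expectation (draws offspring N) (\<lambda>x. s ^ movers ys x + s ^ N)"
    unfolding transition_def
  proof (rule expectation_draws_mono)
    fix x assume "x \<in> set_pmf (draws offspring N)"
    from leaders_step_ge[OF ys this] power_min_le[OF s] 
    show "s ^ leaders (advance N x ys) \<le> s ^ movers ys x + s ^ N" by (simp add: add.commute)
  qed
  also have "\<dots> = pgf s ^ leaders ys + s ^ N"
    by (simp add: integrable_draws expectation_movers ys s)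
  finally show ?thesis .
qed

text \<open>There is always at least one leader, so writing \<open>pgf s ^ leaders ys\<close> as
  \<open>(pgf s / s) ^ leaders ys * s ^ leaders ys\<close> exhibits at least one factor
  \<open>pgf s / s < 1\<close>. The resulting bound is uniform in time.\<close>

lemma iter_leaders_le:
  assumes s: "q \<alpha> < s" "s < 1"
  shows "(T ^^ k) (\<lambda>ys. s ^ leaders ys) origin \<le> s ^ N / (1 - pgf s / s)"
proof (rule iter_drift_bound[where f = "\<lambda>ys. s ^ leaders ys" and h = "\<lambda>_. s ^ N" and ?z0.0 = origin])
  have s0: "0 < s" using s q_pos by linarith
  show "0 \<le> pgf s / s" "pgf s / s < 1" using s0 pgf_less[OF s] by simp_all
  have "0 < s ^ N" "0 \<le> pgf s / s" using s0 by simp_all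
  with \<open>pgf s / s < 1\<close> show "s ^ leaders origin \<le> s ^ N / (1 - pgf s / s)"
    by (simp add: pos_le_divide_eq mult_left_le)
  fix ys :: "int list" assume "ys \<in> {ys. length ys = N}"
  then have ys: "length ys = N" "0 < leaders ys" using N leaders_pos[of ys] by auto
  have "pgf s ^ leaders ys = (pgf s / s) ^ leaders ys * s ^ leaders ys"
    using s0 by (simp add: power_divide)
  also have "\<dots> \<le> pgf s / s * s ^ leaders ys"
    using power_decreasing[of 1 "leaders ys" "pgf s / s"] ys s0 \<open>pgf s / s < 1\<close>
    by (intro mult_right_mono) auto
  finally show "T (\<lambda>ys. s ^ leaders ys) ys \<le> pgf s / s * s ^ leaders ys + s ^ N"
    using transition_leaders_le[OF ys(1), of s] s0 s by simp
qed auto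

section \<open>A potential for the two front sites\<close>

definition front :: "int list \<Rightarrow> nat" where "front ys = leaders ys + followers ys"

text \<open>The base \<open>q \<alpha>\<close> is neutral for the movers; the gain comes from
  \<open>b\<close>. Each leader contributes two particles to the next front, hence
  \<open>b\<^sup>2\<close> instead of \<open>b\<close>, and each follower contributes
  \<open>pgf b\<close> instead of \<open>b\<close>; \<open>\<rho>\<close> is the worse of the two
  ratios. Movers and joiners come from different sites, so their factors are independent. The two
  additive terms pay for the cutoff at \<open>N\<close>: the first when the movers already fill the
  population, the second when only the front does.\<close>

lemma transition_front_le:
  assumes ys: "length ys = N" and b: "q \<alpha> < b" "b < 1"
  defines "\<rho> \<equiv> max b (pgf b / b)"
  shows "T (\<lambda>ys. q \<alpha> ^ leaders ys * b ^ front ys) ys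
     \<le> \<rho> * (q \<alpha> ^ leaders ys * b ^ front ys) + (q \<alpha> ^ N * b ^ N + b ^ N * q \<alpha> ^ leaders ys)"
proof -
  let ?R = "leaders ys" and ?L = "followers ys" and ?q = "q \<alpha>"
  have b0: "0 < b" using b q_pos by linarith
  note q01 = q_pos q_less_1
  have "T (\<lambda>ys. ?q ^ leaders ys * b ^ front ys) ys
      \<le> measure_pmf.expectation (draws offspring N)
         (\<lambda>x. (?q ^ N * b ^ N + b ^ N * ?q ^ movers ys x) + b ^ (2 * ?R) * (?q ^ movers ys x * b ^ joiners ys x))"
    unfolding transition_def
  proof (rule expectation_draws_mono)
    fix x assume x: "x \<in> set_pmf (draws offspring N)"
    let ?y = "advance N x ys" and ?B = "movers ys x" and ?C = "joiners ys x"
    have nn: "0 \<le> b ^ N * ?q ^ ?B" "0 \<le> b ^ (2 * ?R) * (?q ^ ?B * b ^ ?C)" "0 \<le> ?q ^ N * b ^ N"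
      using b0 q01 by simp_all
    show "?q ^ leaders ?y * b ^ front ?y
        \<le> (?q ^ N * b ^ N + b ^ N * ?q ^ ?B) + b ^ (2 * ?R) * (?q ^ ?B * b ^ ?C)"
    proof (cases "N \<le> ?B")
      case True
      then have "N \<le> leaders ?y" using leaders_step_ge[OF ys x] by simp
      then have "?q ^ leaders ?y * b ^ front ?y \<le> ?q ^ N * b ^ N"
        using b0 b q01 by (intro mult_mono power_decreasing) (auto simp: front_def)
      with nn show ?thesis by linarith
    next
      case False
      then have "?q ^ leaders ?y \<le> ?q ^ ?B"
        using leaders_step_ge[OF ys x] q01 by (intro power_decreasing) auto
      moreover have "b ^ front ?y \<le> b ^ N + b ^ (2 * ?R + ?C)"
        using front_step_ge[OF ys x] b0 b by (intro power_min_le) (auto simp: front_def)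
      ultimately have "?q ^ leaders ?y * b ^ front ?y \<le> ?q ^ ?B * (b ^ N + b ^ (2 * ?R + ?C))"
        using b0 q01 by (intro mult_mono) auto
      also have "\<dots> = b ^ N * ?q ^ ?B + b ^ (2 * ?R) * (?q ^ ?B * b ^ ?C)"
        by (simp add: power_add algebra_simps)
      finally show ?thesis using nn by linarith
    qed
  qed
  also have "\<dots> = (?q ^ N * b ^ N + b ^ N * ?q ^ ?R) + b ^ (2 * ?R) * (?q ^ ?R * pgf b ^ ?L)"
    using ys b0 q01
    by (simp add: integrable_draws expectation_movers expectation_movers_joiners pgf_q)
  also have "b ^ (2 * ?R) * (?q ^ ?R * pgf b ^ ?L) \<le> \<rho> * (?q ^ ?R * b ^ front ys)"
  proof -
    have \<rho>: "0 \<le> \<rho>" "\<rho> \<le> 1" using b0 b pgf_less[OF b] by (auto simp: \<rho>_def)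
    have "0 < front ys" using ys N leaders_pos[of ys] by (auto simp: front_def)
    have "b ^ ?R * pgf b ^ ?L = b ^ ?R * ((pgf b / b) ^ ?L * b ^ ?L)"
      using b0 by (simp add: power_divide)
    also have "\<dots> \<le> \<rho> ^ ?R * (\<rho> ^ ?L * b ^ ?L)"
      using b0 by (intro mult_mono power_mono) (auto simp: \<rho>_def)
    also have "\<dots> = \<rho> ^ front ys * b ^ ?L" by (simp add: front_def power_add)
    also have "\<dots> \<le> \<rho> * b ^ ?L"
      using power_decreasing[of 1 "front ys" \<rho>] \<rho> \<open>0 < front ys\<close> b0 by (intro mult_right_mono) auto
    finally have "(b ^ ?R * ?q ^ ?R) * (b ^ ?R * pgf b ^ ?L) \<le> (b ^ ?R * ?q ^ ?R) * (\<rho> * b ^ ?L)"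
      using b0 q01 by (intro mult_left_mono) auto
    then show ?thesis by (simp add: front_def power_add power2_eq_square power_mult algebra_simps power_mult_distrib)
  qed
  finally show ?thesis by simp
qed

text \<open>At \<open>s = q \<alpha>\<close> there is no contraction, because \<open>pgf\<close>
  fixes that point; the estimate has to go through a larger base.\<close>

lemma iter_q_leaders_le:
  assumes s: "q \<alpha> < s" "s < 1"
  shows "(T ^^ k) (\<lambda>ys. q \<alpha> ^ leaders ys) origin \<le> s ^ N / (1 - pgf s / s)"
proof -
  have "(T ^^ k) (\<lambda>ys. q \<alpha> ^ leaders ys) origin \<le> (T ^^ k) (\<lambda>ys. s ^ leaders ys) origin"
    by (rule iter_mono[of origin "\<lambda>ys. q \<alpha> ^ leaders ys" "\<lambda>ys. s ^ leaders ys" k])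
      (use q_pos s in \<open>auto intro: power_mono\<close>)
  also note iter_leaders_le[OF s]
  finally show ?thesis .
qed

text \<open>The factor \<open>b ^ N\<close> outweighs the loss \<open>(s / q \<alpha>) ^ N\<close>
  of \<open>iter_q_leaders_le\<close> as soon as \<open>b * s < q \<alpha>\<close>, and the bound is
  then of smaller order than \<open>q \<alpha> ^ N\<close>.\<close>

lemma iter_front_le:
  assumes b: "q \<alpha> < b" "b < 1" and s: "q \<alpha> < s" "s < 1"
  defines "\<rho> \<equiv> max b (pgf b / b)"
  shows "(T ^^ k) (\<lambda>ys. q \<alpha> ^ leaders ys * b ^ front ys) origin
    \<le> b ^ N * (q \<alpha> ^ N + s ^ N / (1 - pgf s / s)) / (1 - \<rho>)"
proof (rule iter_drift_bound[where f = "\<lambda>ys. q \<alpha> ^ leaders ys * b ^ front ys" and ?z0.0 = origin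
      and h = "\<lambda>ys. q \<alpha> ^ N * b ^ N + b ^ N * q \<alpha> ^ leaders ys"])
  have b0: "0 < b" and s0: "0 < s" using b s q_pos by linarith+
  show \<rho>: "0 \<le> \<rho>" "\<rho> < 1" using b0 b pgf_less[OF b] by (auto simp: \<rho>_def)
  show "(T ^^ j) (\<lambda>ys. q \<alpha> ^ N * b ^ N + b ^ N * q \<alpha> ^ leaders ys) origin
      \<le> b ^ N * (q \<alpha> ^ N + s ^ N / (1 - pgf s / s))" for j
  proof -
    have "(T ^^ j) (\<lambda>ys. q \<alpha> ^ leaders ys) origin \<le> s ^ N / (1 - pgf s / s)"
      by (rule iter_q_leaders_le[OF s])
    then have "b ^ N * (T ^^ j) (\<lambda>ys. q \<alpha> ^ leaders ys) origin \<le> b ^ N * (s ^ N / (1 - pgf s / s))"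
      using b0 by (intro mult_left_mono) auto
    moreover have "(T ^^ j) (\<lambda>ys. q \<alpha> ^ N * b ^ N + b ^ N * q \<alpha> ^ leaders ys) origin
        = q \<alpha> ^ N * b ^ N + b ^ N * (T ^^ j) (\<lambda>ys. q \<alpha> ^ leaders ys) origin"
      by (simp only: iter_add[of j "\<lambda>_. q \<alpha> ^ N * b ^ N"] iter_cmult iter_const)
    ultimately show ?thesis by (simp only: distrib_left mult.commute[of "b ^ N" "q \<alpha> ^ N"])
  qed
  have "0 \<le> s ^ N / (1 - pgf s / s)" using s0 pgf_less[OF s] by simp
  then have "b ^ N * q \<alpha> ^ N \<le> b ^ N * (q \<alpha> ^ N + s ^ N / (1 - pgf s / s))"
    using b0 by (intro mult_left_mono) auto
  also have "\<dots> \<le> b ^ N * (q \<alpha> ^ N + s ^ N / (1 - pgf s / s)) / (1 - \<rho>)"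
    using \<rho> b0 q_pos \<open>0 \<le> s ^ N / (1 - pgf s / s)\<close> 
    by (simp add: pos_le_divide_eq mult_left_le)
  finally show "q \<alpha> ^ leaders origin * b ^ front origin \<le> b ^ N * (q \<alpha> ^ N + s ^ N / (1 - pgf s / s)) / (1 - \<rho>)"
    by (simp add: front_def mult.commute)
  show "T (\<lambda>ys. q \<alpha> ^ leaders ys * b ^ front ys) ys
     \<le> \<rho> * (q \<alpha> ^ leaders ys * b ^ front ys) + (q \<alpha> ^ N * b ^ N + b ^ N * q \<alpha> ^ leaders ys)"
    if "ys \<in> {ys. length ys = N}" for ys
    using transition_front_le[OF _ b, of ys] that unfolding \<rho>_def by simp
qed simp

text \<open>The comparison holds draw by draw. On a failure there are no movers, so
  \<open>q \<alpha> ^ movers ys x = 1\<close> pays for the lost step; on a success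
  \<open>power_min_le\<close> pays for the new leaders.\<close>

lemma failure_le:
  assumes ys: "length ys = N" and b: "q \<alpha> < b" "b < 1"
  shows "1 + real_of_int (top_pos ys) - T height ys \<le>
    q \<alpha> ^ leaders ys - T (\<lambda>ys. q \<alpha> ^ leaders ys) ys
      + (q \<alpha> ^ N + q \<alpha> ^ N * q \<alpha> ^ leaders ys + q \<alpha> ^ leaders ys * b ^ front ys)"
proof -
  let ?R = "leaders ys" and ?L = "followers ys" and ?q = "q \<alpha>"
  note q01 = q_pos q_less_1
  have "measure_pmf.expectation (draws offspring N)
       (\<lambda>x. 1 + real_of_int (top_pos ys) - real_of_int (top_pos (advance N x ys)) + ?q ^ leaders (advance N x ys))
     \<le> measure_pmf.expectation (draws offspring N) (\<lambda>x. ?q ^ movers ys x + ?q ^ N + ?q ^ N * ?q ^ movers ys x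
           + ?q ^ (2 * ?R) * (?q ^ movers ys x * ?q ^ joiners ys x))"
  proof (rule expectation_draws_mono)
    fix x assume x: "x \<in> set_pmf (draws offspring N)"
    \<comment> \<open>The indicator of a failure is relaxed to
      \<open>q \<alpha> ^ movers ys x\<close>, which equals 1 on that event; the cost of the
      restarted leaders then has an expectation in product form.\<close>
    have nn: "0 \<le> ?q ^ N * ?q ^ movers ys x" "0 \<le> ?q ^ (2 * ?R) * (?q ^ movers ys x * ?q ^ joiners ys x)"
      using q01 by simp_all
    from ys x show "1 + real_of_int (top_pos ys) - real_of_int (top_pos (advance N x ys)) + ?q ^ leaders (advance N x ys)
       \<le> ?q ^ movers ys x + ?q ^ N + ?q ^ N * ?q ^ movers ys x
           + ?q ^ (2 * ?R) * (?q ^ movers ys x * ?q ^ joiners ys x)"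
    proof (cases rule: step_cases)
      case success
      then have "?q ^ leaders (advance N x ys) \<le> ?q ^ movers ys x + ?q ^ N"
        using q01 power_min_le[of ?q N "movers ys x" "leaders (advance N x ys)"] by simp
      with success(2) nn show ?thesis by simp
    next
      case failure
      then have "?q ^ leaders (advance N x ys) \<le> ?q ^ N + ?q ^ (2 * ?R + joiners ys x)"
        using q01 by (intro power_min_le) simp_all
      moreover have "0 \<le> ?q ^ N" using q01 by simp
      ultimately show ?thesis using failure(1,2) by (simp add: power_add)
    qed
  qed
  moreover have "?q ^ (2 * ?R) * (?q ^ ?R * ?q ^ ?L) \<le> ?q ^ ?R * b ^ front ys"
  proof -
    have "?q ^ (2 * ?R) * (?q ^ ?R * ?q ^ ?L) = ?q ^ ?R * (?q ^ front ys * ?q ^ ?R)"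
      by (simp add: front_def power_add power2_eq_square power_mult algebra_simps power_mult_distrib)
    also have "\<dots> \<le> ?q ^ ?R * (b ^ front ys * 1)"
      using q01 b by (intro mult_left_mono mult_mono power_mono power_le_one) auto
    finally show ?thesis by simp
  qed
  moreover have "measure_pmf.expectation (draws offspring N)
       (\<lambda>x. 1 + real_of_int (top_pos ys) - real_of_int (top_pos (advance N x ys)) + ?q ^ leaders (advance N x ys))
     = 1 + real_of_int (top_pos ys) - T height ys + T (\<lambda>ys. ?q ^ leaders ys) ys"
    by (simp add: transition_def integrable_draws)
  moreover have "measure_pmf.expectation (draws offspring N) (\<lambda>x. ?q ^ movers ys x + ?q ^ N + ?q ^ N * ?q ^ movers ys x
           + ?q ^ (2 * ?R) * (?q ^ movers ys x * ?q ^ joiners ys x))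
     = ?q ^ ?R + ?q ^ N + ?q ^ N * ?q ^ ?R + ?q ^ (2 * ?R) * (?q ^ ?R * ?q ^ ?L)"
    using ys q01 by (simp add: integrable_draws expectation_movers expectation_movers_joiners pgf_q)
  ultimately show ?thesis by linarith
qed

text \<open>The positive part of \<open>q \<alpha> ^ N - q \<alpha> ^ movers ys x\<close> is bounded
  below by a smooth expression with base \<open>t\<close>. If the movers are at most
  \<open>N\<close>, the subtracted term is at least \<open>q \<alpha> ^ N\<close>; if they exceed
  \<open>N\<close> by \<open>d\<close>, it equals \<open>q \<alpha> ^ N * t ^ d\<close>, which
  dominates \<open>q \<alpha> ^ (N + d)\<close> because \<open>q \<alpha> < t\<close>.\<close>

lemma failure_ge:
  assumes ys: "length ys = N" and t: "q \<alpha> < t" "t < 1"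
  shows "q \<alpha> ^ leaders ys - T (\<lambda>ys. q \<alpha> ^ leaders ys) ys
      + (q \<alpha> ^ N - (q \<alpha> / t) ^ N * pgf t ^ leaders ys)
    \<le> 1 + real_of_int (top_pos ys) - T height ys"
proof -
  let ?q = "q \<alpha>"
  note q01 = q_pos q_less_1
  have t0: "0 < t" using q01 t by linarith
  have "measure_pmf.expectation (draws offspring N) (\<lambda>x. ?q ^ movers ys x + ?q ^ N - (?q / t) ^ N * t ^ movers ys x)
     \<le> measure_pmf.expectation (draws offspring N)
       (\<lambda>x. 1 + real_of_int (top_pos ys) - real_of_int (top_pos (advance N x ys)) + ?q ^ leaders (advance N x ys))"
  proof (rule expectation_draws_mono)
    fix x assume x: "x \<in> set_pmf (draws offspring N)"
    let ?B = "movers ys x"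
    have *: "?q ^ N \<le> (?q / t) ^ N * t ^ ?B" if "?B \<le> N"
    proof -
      have "(?q / t) ^ N * t ^ N \<le> (?q / t) ^ N * t ^ ?B"
        using q01 t t0 that by (intro mult_left_mono power_decreasing) auto
      then show ?thesis using t0 by (simp add: power_divide)
    qed
    from ys x show "?q ^ ?B + ?q ^ N - (?q / t) ^ N * t ^ ?B \<le>
       1 + real_of_int (top_pos ys) - real_of_int (top_pos (advance N x ys)) + ?q ^ leaders (advance N x ys)"
    proof (cases rule: step_cases)
      case success
      show ?thesis
      proof (cases "?B \<le> N")
        case True
        then show ?thesis using success * by simp
      next
        case False
        then obtain d where d: "?B = N + d" using le_Suc_ex[of N ?B] by auto
        have "?q ^ d \<le> t ^ d" using q01 t by (intro power_mono) auto
        then have "?q ^ N * ?q ^ d \<le> ?q ^ N * t ^ d" using q01 by (intro mult_left_mono) auto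
        also have "\<dots> = (?q / t) ^ N * t ^ ?B" using t0 by (simp add: d power_divide power_add)
        finally have "?q ^ ?B \<le> (?q / t) ^ N * t ^ ?B" by (simp add: d power_add)
        then show ?thesis using success False by simp
      qed
    next
      case failure
      moreover have "0 \<le> ?q ^ leaders (advance N x ys)" using q01 by simp
      ultimately show ?thesis using * by simp
    qed
  qed
  moreover have "measure_pmf.expectation (draws offspring N)
       (\<lambda>x. 1 + real_of_int (top_pos ys) - real_of_int (top_pos (advance N x ys)) + ?q ^ leaders (advance N x ys))
     = 1 + real_of_int (top_pos ys) - T height ys + T (\<lambda>ys. ?q ^ leaders ys) ys"
    by (simp add: transition_def integrable_draws)
  moreover have "measure_pmf.expectation (draws offspring N) (\<lambda>x. ?q ^ movers ys x + ?q ^ N - (?q / t) ^ N * t ^ movers ys x)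
     = ?q ^ leaders ys + ?q ^ N - (?q / t) ^ N * pgf t ^ leaders ys"
    using ys q01 t0 by (simp add: integrable_draws expectation_movers pgf_q)
  ultimately show ?thesis by linarith
qed

text \<open>\<open>1 + (height ys - T height ys)\<close> is the probability that the top of
  \<open>ys\<close> does not move in the next step, so both sides are the mean number of failures
  before time \<open>k\<close>.\<close>

lemma sum_failures:
  "(\<Sum>j<k. (T ^^ j) (\<lambda>ys. 1 + (height ys - T height ys)) origin) = real k - (T ^^ k) height origin"
proof -
  have "(\<Sum>j<k. (T ^^ j) (\<lambda>ys. 1 + (height ys - T height ys)) origin) =
    (\<Sum>j<k. 1 + (T ^^ j) (\<lambda>ys. height ys - T height ys) origin)"
    by (simp only: iter_add[where f = "\<lambda>_. 1" and g = "\<lambda>ys. height ys - T height ys"] iter_const)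
  also have "\<dots> = real k + (\<Sum>j<k. (T ^^ j) (\<lambda>ys. height ys - T height ys) origin)"
    by (simp only: sum.distrib) simp
  also have "\<dots> = real k - (T ^^ k) height origin"
    using sum_iter_telescope[of height origin k] by simp
  finally show ?thesis .
qed

lemma iter_power_leaders_bounds:
  "0 \<le> (T ^^ k) (\<lambda>ys. q \<alpha> ^ leaders ys) origin" "(T ^^ k) (\<lambda>ys. q \<alpha> ^ leaders ys) origin \<le> 1"
proof -
  note q01 = q_pos q_less_1
  have "(T ^^ k) (\<lambda>_. 0) origin \<le> (T ^^ k) (\<lambda>ys. q \<alpha> ^ leaders ys) origin"
    by (rule iter_mono[where f = "\<lambda>_. 0" and g = "\<lambda>ys. q \<alpha> ^ leaders ys"]) (use q01 in auto)
  then show "0 \<le> (T ^^ k) (\<lambda>ys. q \<alpha> ^ leaders ys) origin" by simp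
  have "(T ^^ k) (\<lambda>ys. q \<alpha> ^ leaders ys) origin \<le> (T ^^ k) (\<lambda>_. 1) origin"
    by (rule iter_mono[where f = "\<lambda>ys. q \<alpha> ^ leaders ys" and g = "\<lambda>_. 1"])
      (use q01 in \<open>auto intro: power_le_one\<close>)
  then show "(T ^^ k) (\<lambda>ys. q \<alpha> ^ leaders ys) origin \<le> 1" by simp
qed

text \<open>Summing \<open>failure_le\<close> over time leaves a cost per step and the boundary of
  the telescoped sum; the boundary is at most 1 in total, independently of \<open>k\<close>.\<close>

lemma mean_deficit_le:
  assumes b: "q \<alpha> < b" "b < 1" and s: "q \<alpha> < s" "s < 1"
  defines "K \<equiv> 1 / (1 - pgf s / s)" and "\<rho> \<equiv> max b (pgf b / b)"
  shows "real k - (T ^^ k) height origin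
     \<le> 1 + real k * (q \<alpha> ^ N * (1 + K * s ^ N) + b ^ N * (q \<alpha> ^ N + K * s ^ N) / (1 - \<rho>))"
proof -
  let ?q = "q \<alpha>" and ?u = "\<lambda>ys. q \<alpha> ^ leaders ys" and ?v = "\<lambda>ys. q \<alpha> ^ leaders ys * b ^ front ys"
  note q01 = q_pos q_less_1
  let ?c = "?q ^ N * (1 + K * s ^ N) + b ^ N * (?q ^ N + K * s ^ N) / (1 - \<rho>)"
  have "(T ^^ j) (\<lambda>ys. 1 + (height ys - T height ys)) origin
      \<le> (T ^^ j) (\<lambda>ys. ?u ys - T ?u ys) origin + ?c" for j
  proof -
    have "(T ^^ j) (\<lambda>ys. 1 + (height ys - T height ys)) origin
        \<le> (T ^^ j) (\<lambda>ys. (?u ys - T ?u ys) + ((?q ^ N + ?q ^ N * ?u ys) + ?v ys)) origin"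
      by (rule iter_mono[where f = "\<lambda>ys. 1 + (height ys - T height ys)"
          and g = "\<lambda>ys. (?u ys - T ?u ys) + ((?q ^ N + ?q ^ N * ?u ys) + ?v ys)"])
        (use failure_le[OF _ b] in \<open>auto simp: add_diff_eq\<close>)
    also have "\<dots> = (T ^^ j) (\<lambda>ys. ?u ys - T ?u ys) origin + (?q ^ N + ?q ^ N * (T ^^ j) ?u origin + (T ^^ j) ?v origin)"
      by (simp only: iter_add[where f = "\<lambda>ys. ?u ys - T ?u ys"] iter_add[where g = ?v]
        iter_add[where g = "\<lambda>ys. ?q ^ N * ?u ys"] iter_cmult iter_const)
    also have "(T ^^ j) ?u origin \<le> K * s ^ N" using iter_q_leaders_le[OF s, of j] by (simp add: K_def)
    also have "(T ^^ j) ?v origin \<le> b ^ N * (?q ^ N + K * s ^ N) / (1 - \<rho>)"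
      using iter_front_le[OF b s] by (simp add: K_def \<rho>_def)
    finally show ?thesis using q01 by (simp add: distrib_left)
  qed
  then have "real k - (T ^^ k) height origin \<le> (\<Sum>j<k. (T ^^ j) (\<lambda>ys. ?u ys - T ?u ys) origin + ?c)"
    unfolding sum_failures[symmetric] by (rule sum_mono)
  also have "\<dots> = ?q ^ N - (T ^^ k) ?u origin + real k * ?c"
    by (simp only: sum.distrib sum_iter_telescope[where f = ?u]) (simp add: distrib_left)
  also have "\<dots> \<le> 1 + real k * ?c"
    using iter_power_leaders_bounds[of k] q01 power_le_one[of ?q N] by linarith
  finally show ?thesis .
qed

lemma mean_deficit_ge:
  assumes t: "q \<alpha> < t" "t < 1"
  defines "K \<equiv> 1 / (1 - pgf (pgf t) / pgf t)"
  shows "real k * (q \<alpha> ^ N * (1 - K * (pgf t / t) ^ N)) - 1 \<le> real k - (T ^^ k) height origin"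
proof -
  let ?q = "q \<alpha>" and ?u = "\<lambda>ys. q \<alpha> ^ leaders ys"
  note q01 = q_pos q_less_1
  have t0: "0 < t" using q01 t by linarith
  let ?c = "?q ^ N * (1 - K * (pgf t / t) ^ N)"
  \<comment> \<open>\<open>failure_ge\<close> produces powers of \<open>pgf t\<close>, so the leader
    bound is taken at \<open>pgf t\<close> instead of \<open>t\<close>; this is the source of the
    vanishing factor \<open>(pgf t / t) ^ N\<close>.\<close>
  have s: "q \<alpha> < pgf t" "pgf t < 1" using pgf_gt_q[OF t(1)] pgf_less[OF t] t by auto
  have "(T ^^ j) (\<lambda>ys. ?u ys - T ?u ys) origin + ?c
      \<le> (T ^^ j) (\<lambda>ys. 1 + (height ys - T height ys)) origin" for j
  proof -
    have "(?q / t) ^ N * (T ^^ j) (\<lambda>ys. pgf t ^ leaders ys) origin \<le> (?q / t) ^ N * (pgf t ^ N * K)"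
      using iter_leaders_le[OF s] q01 t0 by (intro mult_left_mono) (auto simp: K_def)
    then have "(T ^^ j) (\<lambda>ys. ?u ys - T ?u ys) origin + ?c
       \<le> (T ^^ j) (\<lambda>ys. ?u ys - T ?u ys) origin + (?q ^ N - (?q / t) ^ N * (T ^^ j) (\<lambda>ys. pgf t ^ leaders ys) origin)"
      by (simp add: power_divide algebra_simps)
    also have "\<dots> = (T ^^ j) (\<lambda>ys. (?u ys - T ?u ys) + (?q ^ N - (?q / t) ^ N * pgf t ^ leaders ys)) origin"
      by (simp only: iter_add[where f = "\<lambda>ys. ?u ys - T ?u ys"] iter_diff[where g = "\<lambda>ys. (?q / t) ^ N * pgf t ^ leaders ys"]
        iter_cmult iter_const)
    also have "\<dots> \<le> (T ^^ j) (\<lambda>ys. 1 + (height ys - T height ys)) origin"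
      by (rule iter_mono[where g = "\<lambda>ys. 1 + (height ys - T height ys)"
          and f = "\<lambda>ys. (?u ys - T ?u ys) + (?q ^ N - (?q / t) ^ N * pgf t ^ leaders ys)"])
        (use failure_ge[OF _ t] in \<open>auto simp: add_diff_eq\<close>)
    finally show ?thesis .
  qed
  then have "(\<Sum>j<k. (T ^^ j) (\<lambda>ys. ?u ys - T ?u ys) origin + ?c) \<le> real k - (T ^^ k) height origin"
    unfolding sum_failures[symmetric] by (rule sum_mono)
  moreover have "(\<Sum>j<k. (T ^^ j) (\<lambda>ys. ?u ys - T ?u ys) origin + ?c) = ?q ^ N - (T ^^ k) ?u origin + real k * ?c"
    by (simp only: sum.distrib sum_iter_telescope[where f = ?u]) (simp add: distrib_left)
  moreover have "0 \<le> ?q ^ N" using q01 by simp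
  ultimately show ?thesis using iter_power_leaders_bounds[of k] by linarith
qed

end

section \<open>Existence of the speed\<close>

context markov_step
begin

text \<open>Only the atom at \<open>x0\<close> is evaluated exactly; every other draw is estimated
  by \<open>lo\<close>.\<close>

lemma transition_minorize:
  assumes "x0 \<in> set_pmf (draws p m)" "z \<in> S" "\<And>z. z \<in> S \<Longrightarrow> lo \<le> f z"
  shows "pmf (draws p m) x0 * f (F x0 z) + (1 - pmf (draws p m) x0) * lo \<le> T f z"
proof -
  let ?g = "\<lambda>x. lo + (f (F x0 z) - lo) * indicator {x0} x"
  have "measure_pmf.expectation (draws p m) ?g \<le> T f z"
    unfolding transition_def
    by (rule expectation_draws_mono) (use assms closed in \<open>auto simp: indicator_def\<close>)
  moreover have "measure_pmf.expectation (draws p m) ?g = lo + (f (F x0 z) - lo) * pmf (draws p m) x0"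
    by (simp add: integrable_draws measure_pmf_single)
  ultimately show ?thesis by (simp add: algebra_simps)
qed

lemma iter_ge_const:
  assumes "z \<in> S" "\<And>z. z \<in> S \<Longrightarrow> lo \<le> f z"
  shows "lo \<le> (T ^^ n) f z"
  using iter_mono[of z "\<lambda>_. lo" f n] assms by simp

lemma iter_le_const:
  assumes "z \<in> S" "\<And>z. z \<in> S \<Longrightarrow> f z \<le> hi"
  shows "(T ^^ n) f z \<le> hi"
  using iter_mono[of z f "\<lambda>_. hi" n] assms by simp

lemma iter_minorize:
  assumes x0: "x0 \<in> set_pmf (draws p m)" and z: "z \<in> S" and lo: "\<And>z. z \<in> S \<Longrightarrow> lo \<le> f z"
  defines "r \<equiv> pmf (draws p m) x0"
  shows "r ^ n * f ((F x0 ^^ n) z) + (1 - r ^ n) * lo \<le> (T ^^ n) f z"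
  using z
proof (induction n arbitrary: z)
  case (Suc n)
  have r0: "0 \<le> r" by (simp add: r_def)
  have "r * (r ^ n * f ((F x0 ^^ n) (F x0 z)) + (1 - r ^ n) * lo) + (1 - r) * lo
     \<le> r * (T ^^ n) f (F x0 z) + (1 - r) * lo"
    using Suc.IH[OF closed[OF x0 Suc.prems]] r0 by (intro add_right_mono mult_left_mono)
  also have "\<dots> \<le> T ((T ^^ n) f) z"
    unfolding r_def using iter_ge_const[of _ lo f n] lo
    by (intro transition_minorize[OF x0 Suc.prems, of lo "(T ^^ n) f"]) blast
  finally show ?case by (simp add: funpow_swap1 algebra_simps)
qed simp

lemma iter_majorize:
  assumes x0: "x0 \<in> set_pmf (draws p m)" and z: "z \<in> S" and hi: "\<And>z. z \<in> S \<Longrightarrow> f z \<le> hi"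
  defines "r \<equiv> pmf (draws p m) x0"
  shows "(T ^^ n) f z \<le> r ^ n * f ((F x0 ^^ n) z) + (1 - r ^ n) * hi"
proof -
  have "r ^ n * (- f ((F x0 ^^ n) z)) + (1 - r ^ n) * (- hi) \<le> (T ^^ n) (\<lambda>z. - f z) z"
    unfolding r_def using hi by (intro iter_minorize[OF x0 z, of "- hi" "\<lambda>z. - f z" n]) simp
  moreover have "(T ^^ n) (\<lambda>z. - f z) z = - (T ^^ n) f z"
    using iter_cmult[of n "-1" f z] by simp
  ultimately show ?thesis by simp
qed

lemma transition_second_moment_le:
  assumes D: "\<And>x. x \<in> set_pmf (draws p m) \<Longrightarrow> \<bar>g (F x z) - T g z\<bar> \<le> D"
  shows "T (\<lambda>z. (g z - c)\<^sup>2) z \<le> (T g z - c)\<^sup>2 + D\<^sup>2"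
proof -
  let ?v = "T g z - c"
  have "T (\<lambda>z. (g z - c)\<^sup>2) z \<le> measure_pmf.expectation (draws p m)
      (\<lambda>x. ?v\<^sup>2 + D\<^sup>2 + 2 * ?v * (g (F x z) - T g z))"
    unfolding transition_def[of p m F "\<lambda>z. (g z - c)\<^sup>2"]
  proof (rule expectation_draws_mono)
    fix x assume "x \<in> set_pmf (draws p m)"
    then have "(g (F x z) - T g z)\<^sup>2 \<le> D\<^sup>2" using D by (metis abs_ge_zero power2_abs power_mono)
    then show "(g (F x z) - c)\<^sup>2 \<le> ?v\<^sup>2 + D\<^sup>2 + 2 * ?v * (g (F x z) - T g z)"
      by (simp add: power2_eq_square algebra_simps)
  qed
  also have "\<dots> = ?v\<^sup>2 + D\<^sup>2 + 2 * ?v * (measure_pmf.expectation (draws p m) (\<lambda>x. g (F x z)) - T g z)"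
    by (simp add: integrable_draws)
  also have "\<dots> = ?v\<^sup>2 + D\<^sup>2" by (simp add: transition_def)
  finally show ?thesis .
qed

text \<open>The term linear in \<open>d\<close> is kept because it will have mean zero. The cubic
  term is absorbed using \<open>0 \<le> 2 * (d * (v - d))\<^sup>2\<close>, which raises the
  coefficients 6 and 1 to 8 and 3.\<close>

lemma fourth_power_expansion_le:
  fixes v d D :: real
  assumes "\<bar>d\<bar> \<le> D"
  shows "(v + d) ^ 4 \<le> v ^ 4 + 8 * D\<^sup>2 * v\<^sup>2 + 3 * D ^ 4 + 4 * v ^ 3 * d"
proof -
  have d2: "d\<^sup>2 \<le> D\<^sup>2" using assms by (metis abs_ge_zero power2_abs power_mono)
  have "d ^ 4 \<le> D ^ 4" using d2 power_mono[OF d2, of 2] by (simp flip: power_mult)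
  moreover have "v\<^sup>2 * d\<^sup>2 \<le> v\<^sup>2 * D\<^sup>2" using d2 by (intro mult_left_mono) auto
  moreover have "4 * v * d ^ 3 \<le> 2 * v\<^sup>2 * d\<^sup>2 + 2 * d ^ 4"
  proof -
    have "0 \<le> 2 * (d * (v - d))\<^sup>2" by simp
    also have "\<dots> = 2 * v\<^sup>2 * d\<^sup>2 + 2 * d ^ 4 - 4 * v * d ^ 3" by algebra
    finally show ?thesis by simp
  qed
  moreover have "(v + d) ^ 4 = v ^ 4 + 4 * v ^ 3 * d + 6 * (v\<^sup>2 * d\<^sup>2) + 4 * v * d ^ 3 + d ^ 4"
    by algebra
  ultimately show ?thesis by (simp add: algebra_simps)
qed

lemma transition_fourth_moment_le:
  assumes D: "\<And>x. x \<in> set_pmf (draws p m) \<Longrightarrow> \<bar>g (F x z) - T g z\<bar> \<le> D"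
  shows "T (\<lambda>z. (g z - c) ^ 4) z \<le> (T g z - c) ^ 4 + 8 * D\<^sup>2 * (T g z - c)\<^sup>2 + 3 * D ^ 4"
proof -
  let ?v = "T g z - c"
  let ?K = "?v ^ 4 + 8 * D\<^sup>2 * ?v\<^sup>2 + 3 * D ^ 4"
  have "T (\<lambda>z. (g z - c) ^ 4) z \<le> measure_pmf.expectation (draws p m)
      (\<lambda>x. ?K + 4 * ?v ^ 3 * (g (F x z) - T g z))"
    unfolding transition_def[of p m F "\<lambda>z. (g z - c) ^ 4"]
  proof (rule expectation_draws_mono)
    fix x assume "x \<in> set_pmf (draws p m)"
    from fourth_power_expansion_le[OF D[OF this], of ?v]
    show "(g (F x z) - c) ^ 4 \<le> ?K + 4 * ?v ^ 3 * (g (F x z) - T g z)" by simp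
  qed
  also have "\<dots> = ?K + 4 * ?v ^ 3 * (measure_pmf.expectation (draws p m) (\<lambda>x. g (F x z)) - T g z)"
    by (simp add: integrable_draws)
  also have "\<dots> = ?K" by (simp add: transition_def)
  finally show ?thesis .
qed

context
  fixes h :: "'a \<Rightarrow> real" and D :: real
  assumes D: "\<And>n x z. x \<in> set_pmf (draws p m) \<Longrightarrow> z \<in> S \<Longrightarrow>
      \<bar>(T ^^ n) h (F x z) - (T ^^ Suc n) h z\<bar> \<le> D"
begin

text \<open>Applying to the state at time \<open>j\<close> the iterate of \<open>h\<close> for the
  remaining time gives a martingale, and \<open>D\<close> bounds its increments. The index
  \<open>n\<close> is the time still remaining; it grows in the induction as the last step is
  integrated out.\<close>

lemma iter_second_moment_le:
  assumes "z \<in> S"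
  shows "(T ^^ k) (\<lambda>z. ((T ^^ n) h z - c)\<^sup>2) z \<le> ((T ^^ (n + k)) h z - c)\<^sup>2 + real k * D\<^sup>2"
  using assms
proof (induction k arbitrary: z n)
  case (Suc k)
  have "(T ^^ Suc k) (\<lambda>z. ((T ^^ n) h z - c)\<^sup>2) z = (T ^^ k) (T (\<lambda>z. ((T ^^ n) h z - c)\<^sup>2)) z"
    by (simp only: iter_Suc')
  also have "\<dots> \<le> (T ^^ k) (\<lambda>z. ((T ^^ Suc n) h z - c)\<^sup>2 + D\<^sup>2) z"
  proof (rule iter_mono[OF Suc.prems])
    fix z assume "z \<in> S"
    then show "T (\<lambda>z. ((T ^^ n) h z - c)\<^sup>2) z \<le> ((T ^^ Suc n) h z - c)\<^sup>2 + D\<^sup>2"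
      using transition_second_moment_le[of "(T ^^ n) h" z D c] D[of _ z n] by simp
  qed
  also have "\<dots> = (T ^^ k) (\<lambda>z. ((T ^^ Suc n) h z - c)\<^sup>2) z + D\<^sup>2"
    using iter_add[of k "\<lambda>z. ((T ^^ Suc n) h z - c)\<^sup>2" "\<lambda>_. D\<^sup>2" z] by (simp only: iter_const)
  also have "\<dots> \<le> ((T ^^ (Suc n + k)) h z - c)\<^sup>2 + real k * D\<^sup>2 + D\<^sup>2"
    using Suc.IH[OF Suc.prems, of "Suc n"] by (intro add_right_mono)
  also have "\<dots> = ((T ^^ (n + Suc k)) h z - c)\<^sup>2 + real (Suc k) * D\<^sup>2"
    by (simp only: add_Suc add_Suc_right of_nat_Suc distrib_right mult_1 add.assoc add.commute[of "D\<^sup>2"])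
  finally show ?case .
qed simp

lemma iter_fourth_moment_le:
  assumes "z \<in> S"
  shows "(T ^^ k) (\<lambda>z. ((T ^^ n) h z - c) ^ 4) z
    \<le> ((T ^^ (n + k)) h z - c) ^ 4 + 8 * D\<^sup>2 * real k * ((T ^^ (n + k)) h z - c)\<^sup>2 + 8 * D ^ 4 * (real k)\<^sup>2"
  using assms
proof (induction k arbitrary: z n)
  case (Suc k)
  let ?f = "\<lambda>z. (T ^^ Suc n) h z - c"
  let ?V = "(T ^^ (n + Suc k)) h z - c"
  have "(T ^^ Suc k) (\<lambda>z. ((T ^^ n) h z - c) ^ 4) z = (T ^^ k) (T (\<lambda>z. ((T ^^ n) h z - c) ^ 4)) z"
    by (simp only: iter_Suc')
  also have "\<dots> \<le> (T ^^ k) (\<lambda>z. ?f z ^ 4 + (8 * D\<^sup>2 * (?f z)\<^sup>2 + 3 * D ^ 4)) z"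
  proof (rule iter_mono[OF Suc.prems])
    fix z assume "z \<in> S"
    then show "T (\<lambda>z. ((T ^^ n) h z - c) ^ 4) z \<le> ?f z ^ 4 + (8 * D\<^sup>2 * (?f z)\<^sup>2 + 3 * D ^ 4)"
      using transition_fourth_moment_le[of "(T ^^ n) h" z D c] D[of _ z n] by (simp add: add.assoc)
  qed
  also have "\<dots> = (T ^^ k) (\<lambda>z. ?f z ^ 4) z + (8 * D\<^sup>2 * (T ^^ k) (\<lambda>z. (?f z)\<^sup>2) z + 3 * D ^ 4)"
    by (simp only: iter_add[of k "\<lambda>z. ?f z ^ 4" "\<lambda>z. 8 * D\<^sup>2 * (?f z)\<^sup>2 + 3 * D ^ 4" z]
      iter_add[of k "\<lambda>z. 8 * D\<^sup>2 * (?f z)\<^sup>2" "\<lambda>_. 3 * D ^ 4" z]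
      iter_cmult[of k "8 * D\<^sup>2" "\<lambda>z. (?f z)\<^sup>2" z] iter_const)
  also have "\<dots> \<le> (?V ^ 4 + 8 * D\<^sup>2 * real k * ?V\<^sup>2 + 8 * D ^ 4 * (real k)\<^sup>2)
      + (8 * D\<^sup>2 * (?V\<^sup>2 + real k * D\<^sup>2) + 3 * D ^ 4)"
    using Suc.IH[OF Suc.prems, of "Suc n"] iter_second_moment_le[OF Suc.prems, of k "Suc n" c]
    by (intro add_mono mult_left_mono) (simp_all only: add_Suc add_Suc_right order_refl zero_le_mult_iff zero_le_power2 zero_le_numeral simp_thms)
  also have "\<dots> = ?V ^ 4 + 8 * D\<^sup>2 * real (Suc k) * ?V\<^sup>2 + (8 * (real k)\<^sup>2 + 8 * real k + 3) * D ^ 4"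
    unfolding of_nat_Suc by algebra
  \<comment> \<open>The accumulated variance contributes \<open>8 * k\<close> and the new increment
    3; both fit into the growth from \<open>8 * k\<^sup>2\<close> to
    \<open>8 * (k + 1)\<^sup>2\<close>.\<close>
  also have "\<dots> \<le> ?V ^ 4 + 8 * D\<^sup>2 * real (Suc k) * ?V\<^sup>2 + (8 * (real (Suc k))\<^sup>2) * D ^ 4"
    by (intro add_left_mono mult_right_mono) (simp_all add: power2_eq_square algebra_simps)
  finally show ?case by (simp only: mult.assoc mult.commute[of _ "D ^ 4"] mult.left_commute[of _ "D ^ 4"])
qed simp

end

end

text \<open>Comparing \<open>a (j * k)\<close> both with \<open>k\<close> copies of
  \<open>a j\<close> and with \<open>j\<close> copies of \<open>a k\<close> puts the two quotients
  within \<open>C / j + C / k\<close> of each other.\<close>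

lemma almost_additive_convergent:
  fixes a :: "nat \<Rightarrow> real"
  assumes add: "\<And>j k. \<bar>a (j + k) - a j - a k\<bar> \<le> C"
  shows "\<exists>v. (\<lambda>k. a k / real k) \<longlonglongrightarrow> v"
proof -
  have mult: "\<bar>a (Suc k * j) - real (Suc k) * a j\<bar> \<le> real k * C" for j k
  proof (induction k)
    case (Suc k)
    have "\<bar>a (j + Suc k * j) - a j - a (Suc k * j)\<bar> \<le> C" by (rule add)
    then have "\<bar>a (Suc (Suc k) * j) - real (Suc (Suc k)) * a j\<bar> \<le> C + real k * C"
      using Suc unfolding abs_le_iff by (simp add: algebra_simps)
    then show ?case by (simp add: algebra_simps)
  qed simp
  have C0: "0 \<le> C" using add[of 0 0] by linarith
  have near: "\<bar>a (j * k) / real (j * k) - a j / real j\<bar> \<le> C / real j" if "0 < j" "0 < k" for j k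
  proof -
    obtain l where l: "k = Suc l" using \<open>0 < k\<close> gr0_conv_Suc by auto
    have "\<bar>a (j * k) - real k * a j\<bar> \<le> real k * C"
    proof -
      have "\<bar>a (j * k) - real k * a j\<bar> \<le> real l * C"
        using mult[of l j] unfolding l by (simp only: mult.commute[of j])
      also have "\<dots> \<le> real k * C" using C0 by (intro mult_right_mono) (simp_all add: l)
      finally show ?thesis .
    qed
    moreover have "a (j * k) / real (j * k) - a j / real j = (a (j * k) - real k * a j) / (real j * real k)"
      using that by (simp add: field_simps)
    ultimately show ?thesis using that by (simp add: abs_mult field_simps)
  qed
  have close: "\<bar>a j / real j - a k / real k\<bar> \<le> C / real j + C / real k" if "0 < j" "0 < k" for j k
    using near[OF that] near[OF that(2,1)] by (simp add: mult.commute)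
  have "Cauchy (\<lambda>k. a k / real k)"
  proof (rule metric_CauchyI)
    fix e :: real assume e: "0 < e"
    obtain M :: nat where M: "2 * C / e < real M" using reals_Archimedean2 by blast
    have "dist (a j / real j) (a k / real k) < e" if "Suc M \<le> j" "Suc M \<le> k" for j k
    proof -
      have small: "C / real i < e / 2" if "Suc M \<le> i" for i
      proof -
        have "2 * C / e < real i" using M that by linarith
        then show ?thesis using e that by (simp add: field_simps)
      qed
      have "\<bar>a j / real j - a k / real k\<bar> \<le> C / real j + C / real k"
        by (rule close) (use that in auto)
      then show ?thesis using small[OF that(1)] small[OF that(2)] unfolding dist_real_def by linarith
    qed
    then show "\<exists>M. \<forall>j\<ge>M. \<forall>k\<ge>M. dist (a j / real j) (a k / real k) < e" by blast
  qed
  then show ?thesis using convergent_eq_Cauchy by blast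
qed

section \<open>Bounded dependence on the start and the almost sure speed\<close>

context bbs_process
begin

definition mean_height :: "nat \<Rightarrow> int list \<Rightarrow> real" where
  "mean_height k = (T ^^ k) height"

text \<open>Subtracting the initial height removes the effect of translations, so a bound over all
  configurations becomes possible.\<close>

definition excess :: "nat \<Rightarrow> int list \<Rightarrow> real" where
  "excess k ys = mean_height k ys - height ys"

lemma height_step:
  assumes "length ys = N" "x \<in> set_pmf (draws offspring N)"
  shows "height ys \<le> height (advance N x ys)" "height (advance N x ys) \<le> height ys + 1"
proof -
  have "\<And>i. i < N \<Longrightarrow> x i \<le> 2" by (rule draws_le[OF assms(2)])
  note * = top_pos_advance_bounds[OF N assms(1) this]
  show "height ys \<le> height (advance N x ys)" using *(1) by simp
  have "height (advance N x ys) \<le> real_of_int (top_pos ys + 1)" using *(2) by (simp only: of_int_le_iff)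
  then show "height (advance N x ys) \<le> height ys + 1" by simp
qed

lemma mean_height_bounds:
  assumes "length ys = N"
  shows "height ys \<le> mean_height k ys \<and> mean_height k ys \<le> height ys + real k"
  using assms
proof (induction k arbitrary: ys)
  case (Suc k)
  have "mean_height (Suc k) ys = measure_pmf.expectation (draws offspring N) (\<lambda>x. mean_height k (advance N x ys))"
    by (simp add: mean_height_def transition_def)
  moreover have "measure_pmf.expectation (draws offspring N) (\<lambda>_. height ys)
      \<le> measure_pmf.expectation (draws offspring N) (\<lambda>x. mean_height k (advance N x ys))"
  proof (rule expectation_draws_mono)
    fix x assume x: "x \<in> set_pmf (draws offspring N)"
    show "height ys \<le> mean_height k (advance N x ys)"
      using Suc.IH[OF length_advance[OF Suc.prems], of x] height_step(1)[OF Suc.prems x] by linarith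
  qed
  moreover have "measure_pmf.expectation (draws offspring N) (\<lambda>x. mean_height k (advance N x ys))
      \<le> measure_pmf.expectation (draws offspring N) (\<lambda>_. height ys + real (Suc k))"
  proof (rule expectation_draws_mono)
    fix x assume x: "x \<in> set_pmf (draws offspring N)"
    have "mean_height k (advance N x ys) \<le> height (advance N x ys) + real k"
      using Suc.IH[OF length_advance[OF Suc.prems], of x] by simp
    then show "mean_height k (advance N x ys) \<le> height ys + real (Suc k)"
      using height_step(2)[OF Suc.prems x] by simp
  qed
  ultimately show ?case by simp
qed (simp add: mean_height_def)

lemma mean_height_shift:
  assumes "length ys = N"
  shows "mean_height k (map (\<lambda>y. y + c) ys) = mean_height k ys + real_of_int c"
  using assms
proof (induction k arbitrary: ys)
  case 0
  then have "ys \<noteq> []" using N by auto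
  then show ?case by (simp add: mean_height_def top_pos_shift)
next
  case (Suc k)
  have "mean_height (Suc k) (map (\<lambda>y. y + c) ys) =
      measure_pmf.expectation (draws offspring N) (\<lambda>x. mean_height k (map (\<lambda>y. y + c) (advance N x ys)))"
    by (simp add: mean_height_def transition_def advance_shift)
  also have "\<dots> = measure_pmf.expectation (draws offspring N) (\<lambda>x. mean_height k (advance N x ys) + real_of_int c)"
    using Suc.IH[OF length_advance[OF Suc.prems]] by simp
  also have "\<dots> = mean_height (Suc k) ys + real_of_int c"
    by (simp add: mean_height_def transition_def integrable_draws)
  finally show ?case .
qed

lemma excess_bounds: "length ys = N \<Longrightarrow> 0 \<le> excess k ys \<and> excess k ys \<le> real k"
  using mean_height_bounds[of ys k] by (simp add: excess_def)

lemma excess_replicate: "excess k (replicate N c) = excess k origin"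
proof -
  have "replicate N c = map (\<lambda>y. y + c) origin" by (simp add: origin_def map_replicate)
  then show ?thesis
    using mean_height_shift[of origin k c] mean_height_shift[of origin 0 c]
    by (simp add: excess_def mean_height_def)
qed

lemma mean_height_plus: "mean_height (j + k) ys = mean_height j ys + (T ^^ j) (excess k) ys"
proof -
  have "mean_height (j + k) ys = (T ^^ j) (\<lambda>ys. height ys + excess k ys) ys"
    by (simp add: excess_def mean_height_def iter_plus)
  also have "\<dots> = mean_height j ys + (T ^^ j) (excess k) ys"
    unfolding mean_height_def by (rule iter_add)
  finally show ?thesis .
qed

lemma excess_oscillation:
  obtains C where "0 \<le> C"
    "\<And>k ys ys'. length ys = N \<Longrightarrow> length ys' = N \<Longrightarrow> \<bar>excess k ys - excess k ys'\<bar> \<le> C"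
proof -
  \<comment> \<open>If all children jump for \<open>N\<close> steps, then all particles coalesce at one site, whatever the start.\<close>
  define x0 where "x0 = (\<lambda>i. if i < N then 2 else 0 :: nat)"
  have x0: "x0 \<in> set_pmf (draws offspring N)"
    by (auto simp: draws_def set_Pi_pmf PiE_dflt_def set_offspring x0_def)
  define r where "r = pmf (draws offspring N) x0 ^ N"
  have r: "0 < r" "r \<le> 1"
    using x0 by (auto simp: r_def pmf_positive pmf_le_1 intro: power_le_one)
  \<comment> \<open>\<open>C\<close> is the fixed point of the map sending \<open>w\<close> to
    \<open>N + (1 - r) * w\<close>: a block of \<open>N\<close> steps adds at most \<open>N\<close>
    to the oscillation, while coalescence with probability at least \<open>r\<close> shrinks what
    was there before.\<close>
  define C where "C = real N / r"
  have NC: "real N \<le> C" using r by (simp add: C_def pos_le_divide_eq mult_left_le)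
  have range: "\<exists>lo hi. hi - lo \<le> C \<and> (\<forall>ys. length ys = N \<longrightarrow> lo \<le> excess k ys \<and> excess k ys \<le> hi)" for k
  proof (induction k rule: less_induct)
    case (less k)
    show ?case
    proof (cases "k < N")
      case True
      show ?thesis
        by (rule exI[of _ 0], rule exI[of _ "real k"]) (use True NC excess_bounds[of _ k] in auto)
    next
      case False
      define k' where "k' = k - N"
      have k: "k = N + k'" "k' < k" using False N by (auto simp: k'_def)
      from less[OF k(2)] obtain lo hi where C: "hi - lo \<le> C"
        and w: "\<And>ys. length ys = N \<Longrightarrow> lo \<le> excess k' ys" "\<And>ys. length ys = N \<Longrightarrow> excess k' ys \<le> hi"
        by (elim exE conjE) blast
      let ?a = "excess k' origin"
      have "r * ?a + (1 - r) * lo \<le> excess k ys \<and> excess k ys \<le> real N + (r * ?a + (1 - r) * hi)"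
        if ys: "length ys = N" for ys
      proof -
        have "(advance N x0 ^^ N) ys = replicate N (top_pos ys + int N)"
          unfolding x0_def by (rule advance_all_right_replicate[OF N _ ys]) (rule less_imp_le[OF less_exp])
        then have a: "excess k' ((advance N x0 ^^ N) ys) = ?a" by (simp add: excess_replicate)
        have "r * ?a + (1 - r) * lo \<le> (T ^^ N) (excess k') ys"
          using iter_minorize[OF x0, of ys lo "excess k'" N] ys w by (simp add: r_def a)
        moreover have "(T ^^ N) (excess k') ys \<le> r * ?a + (1 - r) * hi"
          using iter_majorize[OF x0, of ys "excess k'" hi N] ys w by (simp add: r_def a)
        moreover have "excess k ys = excess N ys + (T ^^ N) (excess k') ys"
          using mean_height_plus[of N k' ys] by (simp add: k(1) excess_def)
        ultimately show ?thesis using excess_bounds[OF ys, of N] by linarith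
      qed
      moreover have "(real N + (r * ?a + (1 - r) * hi)) - (r * ?a + (1 - r) * lo) \<le> C"
      proof -
        have "(1 - r) * (hi - lo) \<le> (1 - r) * C" using C r by (intro mult_left_mono) auto
        also have "\<dots> = C - real N" using r by (simp add: C_def field_simps)
        finally show ?thesis by (simp add: algebra_simps)
      qed
      ultimately show ?thesis by blast
    qed
  qed
  have "\<bar>excess k ys - excess k ys'\<bar> \<le> C" if "length ys = N" "length ys' = N" for k ys ys'
  proof -
    from range[of k] obtain lo hi where "hi - lo \<le> C"
      "\<forall>ys. length ys = N \<longrightarrow> lo \<le> excess k ys \<and> excess k ys \<le> hi" by (elim exE conjE)
    with that have "lo \<le> excess k ys" "excess k ys \<le> hi" "lo \<le> excess k ys'" "excess k ys' \<le> hi" by auto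
    with \<open>hi - lo \<le> C\<close> show ?thesis by linarith
  qed
  then show thesis by (rule that[OF order_trans[OF of_nat_0_le_iff NC]])
qed

lemma mean_height_origin_convergent: "\<exists>v. (\<lambda>k. mean_height k origin / real k) \<longlonglongrightarrow> v"
proof -
  obtain C where C: "0 \<le> C"
    "\<And>k ys ys'. length ys = N \<Longrightarrow> length ys' = N \<Longrightarrow> \<bar>excess k ys - excess k ys'\<bar> \<le> C"
    using excess_oscillation by blast
  show ?thesis
  proof (rule almost_additive_convergent)
    fix j k
    have w: "excess k origin - C \<le> excess k ys" "excess k ys \<le> excess k origin + C" if "length ys = N" for ys
      using C(2)[of ys origin k] that by (auto simp: abs_le_iff)
    have "excess k origin - C \<le> (T ^^ j) (excess k) origin"
      by (rule iter_ge_const[of origin "excess k origin - C" "excess k" j]) (use w in auto)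
    moreover have "(T ^^ j) (excess k) origin \<le> excess k origin + C"
      by (rule iter_le_const[of origin "excess k" "excess k origin + C" j]) (use w in auto)
    moreover have "excess k origin = mean_height k origin" by (simp add: excess_def)
    ultimately show "\<bar>mean_height (j + k) origin - mean_height j origin - mean_height k origin\<bar> \<le> C"
      by (simp add: mean_height_plus abs_le_iff)
  qed
qed

lemma fourth_moment_height:
  obtains D where
    "\<And>k. (T ^^ k) (\<lambda>ys. (height ys - mean_height k origin) ^ 4) origin \<le> D * (real k)\<^sup>2"
proof -
  obtain C where C: "0 \<le> C"
    "\<And>k ys ys'. length ys = N \<Longrightarrow> length ys' = N \<Longrightarrow> \<bar>excess k ys - excess k ys'\<bar> \<le> C"
    using excess_oscillation by blast
  \<comment> \<open>Two outcomes of one step differ by at most 1 in height and by at most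
    \<open>C\<close> in the mean gain afterwards; averaging over one of them gives the increment
    bound.\<close>
  have D: "\<bar>(T ^^ n) height (advance N x ys) - (T ^^ Suc n) height ys\<bar> \<le> C + 1"
    if x: "x \<in> set_pmf (draws offspring N)" and ys: "length ys = N" for n x ys
  proof -
    have near: "\<bar>mean_height n (advance N x ys) - mean_height n (advance N x' ys)\<bar> \<le> C + 1"
      if x': "x' \<in> set_pmf (draws offspring N)" for x'
    proof -
      have "\<bar>height (advance N x ys) - height (advance N x' ys)\<bar> \<le> 1"
        using height_step[OF ys x] height_step[OF ys x'] by linarith
      moreover have "\<bar>excess n (advance N x ys) - excess n (advance N x' ys)\<bar> \<le> C"
        by (rule C(2)) (simp_all add: ys)
      ultimately show ?thesis unfolding excess_def by linarith
    qed
    let ?E = "measure_pmf.expectation (draws offspring N)"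
    let ?A = "mean_height n (advance N x ys)"
    have "?E (\<lambda>_. ?A - (C + 1)) \<le> ?E (\<lambda>x'. mean_height n (advance N x' ys))"
      by (rule expectation_draws_mono) (use near in \<open>fastforce simp: abs_le_iff\<close>)
    moreover have "?E (\<lambda>x'. mean_height n (advance N x' ys)) \<le> ?E (\<lambda>_. ?A + (C + 1))"
      by (rule expectation_draws_mono) (use near in \<open>fastforce simp: abs_le_iff\<close>)
    moreover have "?E (\<lambda>x'. mean_height n (advance N x' ys)) = (T ^^ Suc n) height ys"
      by (simp add: mean_height_def transition_def)
    ultimately show ?thesis by (simp add: mean_height_def abs_le_iff)
  qed
  \<comment> \<open>With \<open>n = 0\<close> and the mean itself as centre, the first two terms of
    \<open>iter_fourth_moment_le\<close> vanish.\<close>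
  have "(T ^^ k) (\<lambda>ys. (height ys - mean_height k origin) ^ 4) origin \<le> (8 * (C + 1) ^ 4) * (real k)\<^sup>2" for k
    using iter_fourth_moment_le[of height "C + 1" origin k 0 "mean_height k origin"] D
    by (simp add: mean_height_def)
  then show thesis by (rule that)
qed

sublocale bbs: row_process offspring N "advance N" "bbs N" origin
proof
  show "finite (set_pmf offspring)" by (simp add: set_offspring)
  show "bbs N 0 \<xi> = origin" for \<xi> by (simp add: origin_def)
  have len: "length (bbs N k \<xi>) = N" for k \<xi>
    by (induction k) (simp_all flip: advance_def)
  show "bbs N (Suc k) \<xi> = advance N (env_row N k \<xi>) (bbs N k \<xi>)" for k \<xi>
    unfolding bbs.simps advance_def
    by (rule arg_cong[where f = "keep_rightmost N"], rule branch_cong) (simp add: len env_row_def)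
qed

text \<open>Dividing the fourth moment by \<open>k ^ 4\<close> leaves order
  \<open>1 / k\<^sup>2\<close>, which is summable; variances would leave only \<open>1 / k\<close>.
  The series of fourth powers thus has finite mean, converges almost surely, and its terms tend to
  0.\<close>

lemma AE_height_limit:
  assumes v: "(\<lambda>k. mean_height k origin / real k) \<longlonglongrightarrow> v"
  shows "AE \<xi> in offspring_space offspring. (\<lambda>k. height (bbs N k \<xi>) / real k) \<longlonglongrightarrow> v"
proof -
  let ?M = "offspring_space offspring"
  obtain D where D: "\<And>k. (T ^^ k) (\<lambda>ys. (height ys - mean_height k origin) ^ 4) origin \<le> D * (real k)\<^sup>2"
    using fourth_moment_height by blast
  define X where "X k \<xi> = ((height (bbs N k \<xi>) - mean_height k origin) / real k) ^ 4" for k \<xi>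
  have X0: "0 \<le> X k \<xi>" for k \<xi> by (simp add: X_def)
  have intX: "integrable ?M (X k)" for k
    unfolding X_def by (rule bbs.integrable_Z[of "\<lambda>ys. ((height ys - mean_height k origin) / real k) ^ 4"])
  have EX: "(\<integral>\<xi>. X k \<xi> \<partial>?M) \<le> D / (real k)\<^sup>2" if "0 < k" for k
  proof -
    have "(\<integral>\<xi>. X k \<xi> \<partial>?M) = (T ^^ k) (\<lambda>ys. ((height ys - mean_height k origin) / real k) ^ 4) origin"
      unfolding X_def by (rule bbs.expectation_Z)
    also have "\<dots> = (T ^^ k) (\<lambda>ys. (1 / real k ^ 4) * (height ys - mean_height k origin) ^ 4) origin"
      by (simp add: power_divide)
    also have "\<dots> = (1 / real k ^ 4) * (T ^^ k) (\<lambda>ys. (height ys - mean_height k origin) ^ 4) origin"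
      by (rule iter_cmult)
    also have "\<dots> \<le> (1 / real k ^ 4) * (D * (real k)\<^sup>2)" using D by (intro mult_left_mono) auto
    also have "\<dots> = D / (real k)\<^sup>2" using that by (simp add: field_simps eval_nat_numeral)
    finally show ?thesis .
  qed
  have "summable (\<lambda>k. \<integral>\<xi>. X (Suc k) \<xi> \<partial>?M)"
  proof (rule summable_comparison_test')
    show "summable (\<lambda>k. D * inverse (real (Suc k) ^ 2))"
      using inverse_power_summable[of 2, where ?'a = real] by (intro summable_mult) (subst summable_Suc_iff, simp)
    show "norm (\<integral>\<xi>. X (Suc k) \<xi> \<partial>?M) \<le> D * inverse (real (Suc k) ^ 2)" if "0 \<le> k" for k
    proof -
      have "0 \<le> (\<integral>\<xi>. X (Suc k) \<xi> \<partial>?M)" using X0 by (intro integral_nonneg_AE) simp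
      then show ?thesis using EX[of "Suc k"] by (simp add: divide_inverse)
    qed
  qed
  then have fin: "(\<Sum>k. ennreal (\<integral>\<xi>. X (Suc k) \<xi> \<partial>?M)) < \<infinity>"
    using X0 by (subst suminf_ennreal2) (auto intro!: integral_nonneg_AE)
  have "(\<integral>\<^sup>+\<xi>. (\<Sum>k. ennreal (X (Suc k) \<xi>)) \<partial>?M) = (\<Sum>k. \<integral>\<^sup>+\<xi>. ennreal (X (Suc k) \<xi>) \<partial>?M)"
    using intX by (intro nn_integral_suminf) (auto intro: borel_measurable_integrable)
  also have "\<dots> = (\<Sum>k. ennreal (\<integral>\<xi>. X (Suc k) \<xi> \<partial>?M))"
    using intX X0 by (subst nn_integral_eq_integral) auto
  finally have "(\<integral>\<^sup>+\<xi>. (\<Sum>k. ennreal (X (Suc k) \<xi>)) \<partial>?M) \<noteq> \<infinity>" using fin by auto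
  then have "AE \<xi> in ?M. (\<Sum>k. ennreal (X (Suc k) \<xi>)) \<noteq> \<infinity>"
    using intX by (intro nn_integral_PInf_AE) (auto intro!: borel_measurable_suminf_order borel_measurable_integrable)
  then show ?thesis
  proof eventually_elim
    case (elim \<xi>)
    have "summable (\<lambda>k. X (Suc k) \<xi>)"
      using elim X0 by (intro summable_suminf_not_top) auto
    then have "(\<lambda>k. X (Suc k) \<xi>) \<longlonglongrightarrow> 0" by (rule summable_LIMSEQ_zero)
    then have "(\<lambda>k. ((height (bbs N k \<xi>) - mean_height k origin) / real k) ^ 4) \<longlonglongrightarrow> 0"
      unfolding X_def by (rule LIMSEQ_imp_Suc)
    then have "(\<lambda>k. (height (bbs N k \<xi>) - mean_height k origin) / real k) \<longlonglongrightarrow> 0"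
      by (subst (asm) power_tendsto_0_iff) simp_all
    from tendsto_add[OF this v] show ?case by (simp add: diff_divide_distrib)
  qed
qed

lemma speed_eq:
  assumes v: "(\<lambda>k. mean_height k origin / real k) \<longlonglongrightarrow> v"
  shows "speed \<alpha> N = v"
  unfolding speed_def
proof (rule the_equality)
  let ?M = "offspring_space offspring"
  interpret M: prob_space ?M by (rule prob_space_offspring_space)
  have lim: "AE \<xi> in ?M. (\<lambda>k. real_of_int (Max (set (bbs N k \<xi>))) / real k) \<longlonglongrightarrow> v"
    using AE_height_limit[OF v] by (simp add: top_pos_def)
  then show "AE \<xi> in ?M. (\<lambda>k. real_of_int (Max (set (bbs N k \<xi>))) / real k) \<longlonglongrightarrow> v" .
  fix v' assume "AE \<xi> in ?M. (\<lambda>k. real_of_int (Max (set (bbs N k \<xi>))) / real k) \<longlonglongrightarrow> v'"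
  with lim have "AE \<xi> in ?M. v' = v" by eventually_elim (rule LIMSEQ_unique)
  then show "v' = v" by simp
qed

lemma speed_deficit_le:
  assumes b: "q \<alpha> < b" "b < 1" and s: "q \<alpha> < s" "s < 1"
  defines "K \<equiv> 1 / (1 - pgf s / s)" and "\<rho> \<equiv> max b (pgf b / b)"
  shows "1 - speed \<alpha> N \<le> q \<alpha> ^ N * (1 + K * s ^ N) + b ^ N * (q \<alpha> ^ N + K * s ^ N) / (1 - \<rho>)"
    (is "_ \<le> ?c")
proof -
  obtain v where v: "(\<lambda>k. mean_height k origin / real k) \<longlonglongrightarrow> v"
    using mean_height_origin_convergent by blast
  have "(\<lambda>k. 1 - mean_height k origin / real k) \<longlonglongrightarrow> 1 - v"
    by (intro tendsto_intros v)
  moreover have "(\<lambda>k. 1 / real k + ?c) \<longlonglongrightarrow> 0 + ?c"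
    by (intro tendsto_add tendsto_const lim_1_over_n)
  moreover have "1 - mean_height k origin / real k \<le> 1 / real k + ?c" if "1 \<le> k" for k
  proof -
    have "real k - mean_height k origin \<le> 1 + real k * ?c"
      using mean_deficit_le[OF b s, of k] unfolding mean_height_def K_def \<rho>_def .
    then have "(real k - mean_height k origin) / real k \<le> (1 + real k * ?c) / real k"
      by (intro divide_right_mono) auto
    then show ?thesis using that by (simp add: diff_divide_distrib add_divide_distrib)
  qed
  ultimately have "1 - v \<le> 0 + ?c" by (intro LIMSEQ_le) blast+
  then show ?thesis using speed_eq[OF v] by simp
qed

lemma speed_deficit_ge:
  assumes t: "q \<alpha> < t" "t < 1"
  defines "K \<equiv> 1 / (1 - pgf (pgf t) / pgf t)"
  shows "q \<alpha> ^ N * (1 - K * (pgf t / t) ^ N) \<le> 1 - speed \<alpha> N" (is "?c \<le> _")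
proof -
  obtain v where v: "(\<lambda>k. mean_height k origin / real k) \<longlonglongrightarrow> v"
    using mean_height_origin_convergent by blast
  have "(\<lambda>k. 1 - mean_height k origin / real k) \<longlonglongrightarrow> 1 - v"
    by (intro tendsto_intros v)
  moreover have "(\<lambda>k. ?c - 1 / real k) \<longlonglongrightarrow> ?c - 0"
    by (intro tendsto_diff tendsto_const lim_1_over_n)
  moreover have "?c - 1 / real k \<le> 1 - mean_height k origin / real k" if "1 \<le> k" for k
  proof -
    have "real k * ?c - 1 \<le> real k - mean_height k origin"
      using mean_deficit_ge[OF t, of k] unfolding mean_height_def K_def .
    then have "(real k * ?c - 1) / real k \<le> (real k - mean_height k origin) / real k"
      by (intro divide_right_mono) auto
    then show ?thesis using that by (simp add: diff_divide_distrib)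
  qed
  ultimately have "?c - 0 \<le> 1 - v" by (intro LIMSEQ_le) blast+
  then show ?thesis using speed_eq[OF v] by simp
qed

end

section \<open>Extinction probability and asymptotics of the speed\<close>

text \<open>
  Reading only finitely many entries of each row makes this a \<^locale>\<open>row_process\<close>; almost surely
  no truncation occurs up to time \<open>k\<close> if \<open>2 ^ k \<le> m\<close>.
\<close>

primrec gw_truncated :: "nat \<Rightarrow> nat \<Rightarrow> (nat \<times> nat \<Rightarrow> nat) \<Rightarrow> nat" where
  "gw_truncated m 0 \<xi> = 1"
| "gw_truncated m (Suc k) \<xi> = (\<Sum>i<gw_truncated m k \<xi>. env_row m k \<xi> i)"

lemma gw_eq_truncated:
  assumes "\<And>i. \<xi> i \<le> 2" "2 ^ k \<le> m"
  shows "gw k \<xi> = gw_truncated m k \<xi>"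
proof -
  have le: "gw j \<xi> \<le> 2 ^ j" for j
  proof (induction j)
    case (Suc j)
    have "gw (Suc j) \<xi> \<le> (\<Sum>i<gw j \<xi>. 2)" unfolding gw.simps using assms(1) by (intro sum_mono)
    then show ?case using Suc by simp
  qed simp
  have "j \<le> k \<Longrightarrow> gw j \<xi> = gw_truncated m j \<xi>" for j
  proof (induction j)
    case (Suc j)
    have "(2::nat) ^ j \<le> 2 ^ k" using Suc.prems by (intro power_increasing) auto
    then have "gw j \<xi> \<le> m" using le[of j] assms(2) by linarith
    then show ?case using Suc by (auto simp: env_row_def intro!: sum.cong)
  qed simp
  then show ?thesis by blast
qed

lemma space_offspring_space [simp]: "space (offspring_space p) = UNIV"
  by (auto simp: offspring_space_def space_PiM)

text \<open>The upper summation limit is itself random; as it takes countably many values, a fixed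
  limit suffices.\<close>

lemma measurable_gw: "gw k \<in> measurable (offspring_space p) (count_space UNIV)"
proof (induction k)
  case 0
  have "gw 0 = (\<lambda>_. 1)" by (simp add: fun_eq_iff)
  then show ?case by simp
next
  case (Suc k)
  have coord: "(\<lambda>\<xi>. \<xi> i) \<in> measurable (offspring_space p) (count_space UNIV)" for i
    unfolding offspring_space_def
    by (rule measurable_compose[OF measurable_component_singleton[of i UNIV "\<lambda>_. measure_pmf p"]]) auto
  have "(\<lambda>\<xi>. \<Sum>i<j. \<xi> (k, i)) \<in> measurable (offspring_space p) (count_space UNIV)" for j
  proof (induction j)
    case (Suc j)
    have "(\<lambda>\<xi>. (\<lambda>a \<xi>. a + \<xi> (k, j)) (\<Sum>i<j. \<xi> (k, i)) \<xi>) \<in> measurable (offspring_space p) (count_space UNIV)"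
    proof (rule measurable_compose_countable[OF _ Suc])
      fix a :: nat
      show "(\<lambda>\<xi>. a + \<xi> (k, j)) \<in> measurable (offspring_space p) (count_space UNIV)"
        by (rule measurable_compose[OF coord]) simp
    qed
    then show ?case by simp
  qed simp
  from measurable_compose_countable[OF this Suc] show ?case by simp
qed

lemma sets_gw_extinct: "{\<xi>. gw k \<xi> = 0} \<in> sets (offspring_space p)"
  using measurable_sets[OF measurable_gw[of k p], of "{0}"]
  by (simp add: space_offspring_space vimage_def)

section \<open>The extinction probability and the limit\<close>

context supercritical
begin

text \<open>The budget \<open>z * 2 ^ k \<le> m\<close> survives a step, since \<open>z\<close> at
  most doubles while \<open>k\<close> drops by one; the sum therefore always runs over genuine
  draws.\<close>

lemma expectation_truncated_gw:
  assumes "0 \<le> s" "z * 2 ^ k \<le> m"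
  shows "(transition offspring m (\<lambda>x z. \<Sum>i<z. x i) ^^ k) (\<lambda>z. s ^ z) z = ((pgf ^^ k) s) ^ z"
  using assms(2)
proof (induction k arbitrary: z)
  case (Suc k)
  let ?T = "transition offspring m (\<lambda>x z. \<Sum>i<z. x i)"
  have s: "0 \<le> (pgf ^^ k) s" using assms(1) by (cases k) auto
  have "z * 1 \<le> z * 2 ^ Suc k" by (intro mult_le_mono2) simp
  also note Suc.prems
  finally have z: "{..<z} \<subseteq> {..<m}" by auto
  have "(?T ^^ Suc k) (\<lambda>z. s ^ z) z
     = measure_pmf.expectation (draws offspring m) (\<lambda>x. (?T ^^ k) (\<lambda>z. s ^ z) (\<Sum>i<z. x i))"
    by (simp add: transition_def)
  also have "\<dots> = measure_pmf.expectation (draws offspring m) (\<lambda>x. ((pgf ^^ k) s) ^ (\<Sum>i<z. x i))"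
  proof (rule integral_cong_AE)
    show "AE x in draws offspring m. (?T ^^ k) (\<lambda>z. s ^ z) (\<Sum>i<z. x i) = ((pgf ^^ k) s) ^ (\<Sum>i<z. x i)"
    proof (rule AE_pmfI)
      fix x assume "x \<in> set_pmf (draws offspring m)"
      then have "(\<Sum>i<z. x i) \<le> (\<Sum>i<z. 2)" by (intro sum_mono draws_le)
      then have "(\<Sum>i<z. x i) * 2 ^ k \<le> (z * 2) * 2 ^ k" by (intro mult_le_mono1) simp
      also have "\<dots> = z * 2 ^ Suc k" by (simp only: power_Suc mult.assoc)
      also note Suc.prems
      finally show "(?T ^^ k) (\<lambda>z. s ^ z) (\<Sum>i<z. x i) = ((pgf ^^ k) s) ^ (\<Sum>i<z. x i)"
        by (rule Suc.IH)
    qed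
  qed simp_all
  also have "\<dots> = pgf ((pgf ^^ k) s) ^ z"
    using expectation_draws_power_sum[OF z, of "{}" "(pgf ^^ k) s" 1] s by simp
  finally show ?case by simp
qed simp

text \<open>\<open>0 ^ n\<close> is the indicator of \<open>n = 0\<close>, so extinction by time
  \<open>k\<close> is the generating function at 0. Starting from one individual,
  \<open>2 ^ k\<close> entries per row are enough.\<close>

lemma prob_gw_extinct_by: "measure (offspring_space offspring) {\<xi>. gw k \<xi> = 0} = (pgf ^^ k) 0"
proof -
  let ?M = "offspring_space offspring" and ?F = "\<lambda>x z. \<Sum>i<z. x i :: nat"
  interpret row_process offspring "2 ^ k" ?F "gw_truncated (2 ^ k)" 1
    by unfold_locales (simp_all add: set_offspring)

  note meas = sets_gw_extinct[of k offspring]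
  have "measure ?M {\<xi>. gw k \<xi> = 0} = (\<integral>\<xi>. indicator {\<xi>. gw k \<xi> = 0} \<xi> \<partial>?M)"
    using meas by (simp add: space_offspring_space)
  also have "\<dots> = (\<integral>\<xi>. 0 ^ gw_truncated (2 ^ k) k \<xi> \<partial>?M)"
  proof (rule integral_cong_AE)
    have "AE \<xi> in ?M. \<forall>i. \<xi> i \<le> 2" by (rule AE_offspring_space) (simp add: set_offspring)
    then show "AE \<xi> in ?M. indicator {\<xi>. gw k \<xi> = 0} \<xi> = (0::real) ^ gw_truncated (2 ^ k) k \<xi>"
    proof eventually_elim
      case (elim \<xi>)
      then have "gw k \<xi> = gw_truncated (2 ^ k) k \<xi>" by (intro gw_eq_truncated) auto
      then show ?case by (simp add: indicator_def power_0_left)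
    qed
    show "(\<lambda>\<xi>. (0::real) ^ gw_truncated (2 ^ k) k \<xi>) \<in> borel_measurable ?M"
      by (rule borel_measurable_integrable) (rule integrable_Z[of "\<lambda>z. 0 ^ z"])
  qed (use meas in simp)
  also have "\<dots> = (transition offspring (2 ^ k) ?F ^^ k) (\<lambda>z. 0 ^ z) 1"
    by (rule expectation_Z)
  also have "\<dots> = (pgf ^^ k) 0" by (subst expectation_truncated_gw) simp_all
  finally show ?thesis .
qed

text \<open>The limit of the iterates of \<open>pgf\<close> at 0 is a fixed point, hence 1 or
  \<open>q \<alpha>\<close>; by monotonicity the iterates never pass \<open>q \<alpha>\<close>,
  which excludes 1.\<close>

lemma gw_extinction_prob_eq: "gw_extinction_prob offspring = q \<alpha>"
proof -
  let ?M = "offspring_space offspring"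
  interpret prob_space ?M by (rule prob_space_offspring_space)

  have meas: "{\<xi>. gw k \<xi> = 0} \<in> sets ?M" for k by (rule sets_gw_extinct)
  have inc: "incseq (\<lambda>k. {\<xi>. gw k \<xi> = 0})" by (rule incseq_SucI) auto
  have "(\<lambda>k. prob {\<xi>. gw k \<xi> = 0}) \<longlonglongrightarrow> prob (\<Union>k. {\<xi>. gw k \<xi> = 0})"
    by (rule finite_Lim_measure_incseq[OF _ inc]) (use meas in auto)
  moreover have "(\<Union>k. {\<xi>. gw k \<xi> = 0}) = {\<xi>. \<exists>k. gw k \<xi> = 0}" by auto
  ultimately have lim: "(\<lambda>k. (pgf ^^ k) 0) \<longlonglongrightarrow> gw_extinction_prob offspring" (is "_ \<longlonglongrightarrow> ?L")
    by (simp add: prob_gw_extinct_by gw_extinction_prob_def)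
  have le: "0 \<le> (pgf ^^ k) 0 \<and> (pgf ^^ k) 0 \<le> q \<alpha>" for k
  proof (induction k)
    case (Suc k)
    then show ?case using pgf_mono[of "(pgf ^^ k) 0" "q \<alpha>"] by (simp add: pgf_q)
  qed (use q_pos in simp)
  have "?L \<le> q \<alpha>" using lim by (rule LIMSEQ_le_const2) (use le in blast)
  have "(\<lambda>k. pgf ((pgf ^^ k) 0)) \<longlonglongrightarrow> pgf ?L"
    unfolding pgf_def[of "?L"] pgf_def[of "(pgf ^^ _) 0"] by (intro tendsto_intros lim)
  moreover have "(\<lambda>k. pgf ((pgf ^^ k) 0)) \<longlonglongrightarrow> ?L" using LIMSEQ_Suc[OF lim] by simp
  ultimately have "pgf ?L = ?L" by (rule LIMSEQ_unique)
  then have "?L = 1 \<or> ?L = q \<alpha>" using pgf_diff[of ?L] \<alpha>_gt by auto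
  then show ?thesis using \<open>?L \<le> q \<alpha>\<close> q_less_1 by auto
qed

lemma speed_deficit_asymptotics: "(\<lambda>N. (1 - speed \<alpha> N) / q \<alpha> ^ N) \<longlonglongrightarrow> 1"
proof -
  note q01 = q_pos q_less_1
  \<comment> \<open>Any \<open>b\<close> strictly between \<open>q \<alpha>\<close> and 1 would do.
    Then \<open>s\<close> is the midpoint of \<open>q \<alpha>\<close> and
    \<open>q \<alpha> / b\<close>, which ensures \<open>b * s < q \<alpha>\<close>.\<close>
  define b where "b = (1 + q \<alpha>) / 2"
  define s where "s = (q \<alpha> + q \<alpha> / b) / 2"
  have b: "q \<alpha> < b" "b < 1" "0 < b" using q01 by (auto simp: b_def)
  have qb: "q \<alpha> < q \<alpha> / b" "q \<alpha> / b < 1"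
    using q01 b by (simp_all add: pos_less_divide_eq pos_divide_less_eq)
  have s: "q \<alpha> < s" "s < 1" "0 < s" using qb q01 by (auto simp: s_def)
  have "b * s < q \<alpha>"
  proof -
    have "b * s = (b * q \<alpha> + q \<alpha>) / 2" using b by (simp add: s_def field_simps)
    moreover have "b * q \<alpha> < q \<alpha>" using b q01 by simp
    ultimately show ?thesis by simp
  qed
  then have bs: "0 \<le> b * s / q \<alpha>" "b * s / q \<alpha> < 1" using b s q01 by simp_all
  define K where "K = 1 / (1 - pgf s / s)"
  define K' where "K' = 1 / (1 - pgf (pgf b) / pgf b)"
  define c where "c = 1 / (1 - max b (pgf b / b))"
  have pb: "0 \<le> pgf b / b" "pgf b / b < 1" using b pgf_less[of b] by simp_all
  have upper: "(1 - speed \<alpha> N) / q \<alpha> ^ N \<le> 1 + K * s ^ N + c * (b ^ N + K * (b * s / q \<alpha>) ^ N)"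
    and lower: "1 - K' * (pgf b / b) ^ N \<le> (1 - speed \<alpha> N) / q \<alpha> ^ N" if "0 < N" for N
  proof -
    interpret bbs_process \<alpha> N by unfold_locales (rule that)
    have qN: "0 < q \<alpha> ^ N" using q01 by simp
    have "1 - speed \<alpha> N \<le> q \<alpha> ^ N * (1 + K * s ^ N) + b ^ N * (q \<alpha> ^ N + K * s ^ N) * c"
      using speed_deficit_le[OF b(1,2) s(1,2)] by (simp add: K_def c_def)
    also have "\<dots> = (1 + K * s ^ N + c * (b ^ N + K * (b * s / q \<alpha>) ^ N)) * q \<alpha> ^ N"
      using qN q01 by (simp add: power_divide power_mult_distrib field_simps)
    finally show "(1 - speed \<alpha> N) / q \<alpha> ^ N \<le> 1 + K * s ^ N + c * (b ^ N + K * (b * s / q \<alpha>) ^ N)"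
      using qN by (simp add: pos_divide_le_eq)
    show "1 - K' * (pgf b / b) ^ N \<le> (1 - speed \<alpha> N) / q \<alpha> ^ N"
      using speed_deficit_ge[OF b(1,2)] qN by (simp add: K'_def pos_le_divide_eq mult.commute)
  qed
  have pow: "(\<lambda>N. r ^ N) \<longlonglongrightarrow> 0" if "0 \<le> r" "r < 1" for r :: real
    using that by (rule LIMSEQ_realpow_zero)
  show ?thesis
  proof (rule tendsto_sandwich)
    show "\<forall>\<^sub>F N in sequentially. 1 - K' * (pgf b / b) ^ N \<le> (1 - speed \<alpha> N) / q \<alpha> ^ N"
      using eventually_gt_at_top[of 0] by eventually_elim (rule lower)
    show "\<forall>\<^sub>F N in sequentially. (1 - speed \<alpha> N) / q \<alpha> ^ N
        \<le> 1 + K * s ^ N + c * (b ^ N + K * (b * s / q \<alpha>) ^ N)"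
      using eventually_gt_at_top[of 0] by eventually_elim (rule upper)
    have "(\<lambda>N. 1 - K' * (pgf b / b) ^ N) \<longlonglongrightarrow> 1 - K' * 0"
      by (intro tendsto_intros pow pb)
    then show "(\<lambda>N. 1 - K' * (pgf b / b) ^ N) \<longlonglongrightarrow> 1" by simp
    have "(\<lambda>N. 1 + K * s ^ N + c * (b ^ N + K * (b * s / q \<alpha>) ^ N)) \<longlonglongrightarrow> 1 + K * 0 + c * (0 + K * 0)"
      by (intro tendsto_intros pow bs less_imp_le b s)
    then show "(\<lambda>N. 1 + K * s ^ N + c * (b ^ N + K * (b * s / q \<alpha>) ^ N)) \<longlonglongrightarrow> 1" by simp
  qed
qed

end

theorem mainTheorem3:
  fixes \<alpha> :: real
  assumes "1 / 2 < \<alpha>" and "\<alpha> < 1"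
  shows "(\<lambda>N. (1 - speed \<alpha> N) / q \<alpha> ^ N) \<longlonglongrightarrow> 1 \<and>
         q \<alpha> = gw_extinction_prob (binomial_pmf 2 \<alpha>)"
proof -
  interpret supercritical \<alpha> using assms by unfold_locales
  show ?thesis using speed_deficit_asymptotics gw_extinction_prob_eq by simp
qed

end
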